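(* For each positive integer $n$ let $P_n$ be the $n$-path (vertices $1,\dots,n$, with an edge between $i$ and $i+1$ for $i=1,\dots,n-1$), and let $T_n$ be the geometric pebbling threshold of $P_n$. Then, as $n\to\infty$, $$T_n= e\,\frac{2^{\sqrt{\log_2 n}}}{\sqrt{\log_2 n}}\, n\left(1+O\!\left(\frac{1}{(\log n)^{1/4}}\right)\right).$$
   Context: Pebbling: a distribution on a graph assigns a nonnegative integer number of pebbles to each vertex. A pebbling move removes two pebbles from a vertex having at least two pebbles and adds one pebble to an adjacent vertex. A vertex is pebblable if some sequence of pebbling moves from the distribution ends with at least one pebble on it; a distribution is solvable if every vertex is pebblable. The geometric distribution on $\{0,1,2,\dots\}$ with parameter $0<p\le 1$ assigns probability $p(1-p)^k$ to $k$. For a graph $H$ with $n>0$ vertices, the geometric pebbling threshold of $H$ is the unique positive real $x$ such that, if an independent geometrically distributed number of pebbles with parameter $(1+x/n)^{-1}$ is placed on each vertex of $H$, the probability that the distribution is solvable equals $\tfrac12$. $\log$ is the natural logarithm. *)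

theory Defs
  imports "HOL-Probability.Probability" "HOL-Library.Landau_Symbols"
begin

definition path_adj :: "nat \<Rightarrow> nat \<Rightarrow> nat \<Rightarrow> bool" where
  "path_adj n u v \<longleftrightarrow> u \<in> {1..n} \<and> v \<in> {1..n} \<and> (v = u + 1 \<or> u = v + 1)"

definition path_peb_move :: "nat \<Rightarrow> (nat \<Rightarrow> nat) \<Rightarrow> (nat \<Rightarrow> nat) \<Rightarrow> bool" where
  "path_peb_move n d d' \<longleftrightarrow>
     (\<exists>v u. path_adj n v u \<and> d v \<ge> 2 \<and> d' = d(v := d v - 2, u := d u + 1))"

definition path_pebblable :: "nat \<Rightarrow> (nat \<Rightarrow> nat) \<Rightarrow> nat \<Rightarrow> bool" where
  "path_pebblable n d w \<longleftrightarrow> (\<exists>d'. (path_peb_move n)\<^sup>*\<^sup>* d d' \<and> d' w \<ge> 1)"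

definition path_solvable :: "nat \<Rightarrow> (nat \<Rightarrow> nat) \<Rightarrow> bool" where
  "path_solvable n d \<longleftrightarrow> (\<forall>w \<in> {1..n}. path_pebblable n d w)"

definition path_solv_prob :: "nat \<Rightarrow> real \<Rightarrow> real" where
  "path_solv_prob n q =
     measure_pmf.prob (Pi_pmf {1..n} 0 (\<lambda>_. geometric_pmf q)) {d. path_solvable n d}"

definition geom_threshold_path :: "nat \<Rightarrow> real" where
  "geom_threshold_path n =
     (THE x. x > 0 \<and> path_solv_prob n (inverse (1 + x / real n)) = 1 / 2)"

end

theory Submission
  imports Defs "HOL-Real_Asymp.Real_Asymp"
begin

text \<open>
  A vertex \<open>v\<close> cannot be pebbled iff it is empty and on each side the pebbles \<open>d u\<close>, weighted by
  \<open>2 ^ -\<bar>u - v\<bar>\<close>, sum to less than \<open>1\<close>. Let \<open>l = x / n\<close> be the mean number of pebbles per vertex and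
  \<open>q = 1 / (1 + l)\<close>. The probability that one side has weight less than \<open>1\<close> is about
  \<open>q ^ m * 2 ^ (m * (m + 1) / 2) / m!\<close>, which is \<open>q ^ m\<close> times the volume of the simplex
  \<open>\<Sum>k\<le>m. x k / 2 ^ k < 1\<close>, with \<open>m\<close> close to the value minimising this expression. Requiring
  \<open>n * q\<close> times its square to be of order \<open>1\<close> gives \<open>l = e * 2 ^ s / s\<close> with \<open>s = sqrt (log 2 n)\<close>, and
  a factor \<open>exp (O (sqrt s))\<close> lost in the probabilities changes \<open>l\<close> only by a factor \<open>1 + O (1 / sqrt s)\<close>.

  From above, the probability is bounded with the exponential moment method and a union bound over the
  vertices. From below, the lattice points of the simplex are counted for
  \<open>m = s - log 2 s / 2 + O (1)\<close>; the vertices farther away contribute \<open>O (1 / sqrt s)\<close> to the weight by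
  Markov's inequality, and the events for the centres of disjoint blocks of \<open>O (log n)\<close> vertices are
  independent. The probability of being solvable is a polynomial in \<open>q\<close>, strictly decreasing on
  \<open>(0, 1)\<close>, hence the threshold is well defined and lies between the two bounds.
\<close>

subsection \<open>Unpebblable vertices of a path\<close>

text \<open>Distance on \<open>nat\<close>: subtraction is truncated, so at most one of the two
  summands is nonzero.\<close>

definition gap :: "nat \<Rightarrow> nat \<Rightarrow> nat" where
  "gap u v = (u - v) + (v - u)"

text \<open>The usual pebbling potential: a move inside \<open>A\<close> one step towards
  \<open>v\<close> leaves it unchanged, one step away from \<open>v\<close> lowers it.\<close>

definition weight :: "nat set \<Rightarrow> (nat \<Rightarrow> nat) \<Rightarrow> nat \<Rightarrow> real" where
  "weight A d v = (\<Sum>u\<in>A. real (d u) / 2 ^ gap u v)"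

text \<open>The sides are bounded separately: while \<open>v\<close> is empty nothing has crossed
  it, so one side alone would have to supply weight 1.\<close>

definition stuck :: "nat \<Rightarrow> (nat \<Rightarrow> nat) \<Rightarrow> nat \<Rightarrow> bool" where
  "stuck n d v \<longleftrightarrow> d v = 0 \<and> weight {1..<v} d v < 1 \<and> weight {v<..n} d v < 1"

section \<open>Change of the weight under pebbling moves\<close>

lemma weight_mono:
  assumes "\<And>u. u \<in> A \<Longrightarrow> d u \<le> d' u"
  shows "weight A d v \<le> weight A d' v"
  unfolding weight_def using assms by (intro sum_mono divide_right_mono) auto

lemma weight_cong: "(\<And>u. u \<in> A \<Longrightarrow> d u = d' u) \<Longrightarrow> weight A d v = weight A d' v"
  by (simp add: weight_def)

lemma weight_member:
  assumes "finite A" "u \<in> A"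
  shows "real (d u) / 2 ^ gap u v \<le> weight A d v"
  unfolding weight_def using assms
  by (intro member_le_sum[where f="\<lambda>u. real (d u) / 2 ^ gap u v"]) auto

lemma weight_subset:
  assumes "finite B" "A \<subseteq> B"
  shows "weight A d v \<le> weight B d v"
  unfolding weight_def using assms by (intro sum_mono2) auto

lemma weight_union:
  assumes "finite A" "finite B" "A \<inter> B = {}"
  shows "weight (A \<union> B) d v = weight A d v + weight B d v"
  unfolding weight_def using assms by (intro sum.union_disjoint) auto

lemma weight_union3:
  assumes "finite A" "finite B" "finite C" "A \<inter> B = {}" "A \<inter> C = {}" "B \<inter> C = {}"
  shows "weight (A \<union> B \<union> C) d v = weight A d v + weight B d v + weight C d v"
  using assms by (simp add: weight_union Int_Un_distrib2)

lemma weight_move: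
  assumes "finite A" "a \<in> A" "b \<in> A" "a \<noteq> b" "2 \<le> d a"
  shows "weight A (d(a := d a - 2, b := d b + 1)) v
           = weight A d v - 2 / 2 ^ gap a v + 1 / 2 ^ gap b v"
proof -
  have split: "weight A f v = weight (A - {a, b}) f v + (f a / 2 ^ gap a v + f b / 2 ^ gap b v)" for f
    unfolding weight_def using assms by (subst sum.subset_diff[of "{a, b}" A]) auto
  have "weight (A - {a, b}) (d(a := d a - 2, b := d b + 1)) v = weight (A - {a, b}) d v"
    by (rule weight_cong) auto
  then show ?thesis
    using assms by (simp add: split field_simps of_nat_diff)
qed

lemma weight_move_le:
  assumes "finite A" "a \<in> A" "b \<in> A" "a \<noteq> b" "2 \<le> d a" "gap a v \<le> gap b v + 1"
  shows "weight A (d(a := d a - 2, b := d b + 1)) v \<le> weight A d v"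
proof -
  have "(2::real) ^ gap a v \<le> 2 ^ (gap b v + 1)"
    using assms by (intro power_increasing) auto
  then have "1 / 2 ^ gap b v \<le> 2 / (2::real) ^ gap a v"
    by (simp add: field_simps)
  then show ?thesis
    using weight_move[where d=d and v=v, OF assms(1-5)] by simp
qed

text \<open>A move onto \<open>v\<close> would need two pebbles on a neighbour, which alone give
  that side weight 1. No move starts at the empty \<open>v\<close>, so every other move stays on one
  side, where it cannot raise the weight.\<close>

lemma stuck_move:
  assumes "path_peb_move n d d'" "stuck n d v"
  shows "stuck n d' v"
proof -
  obtain a b where ab: "path_adj n a b" "2 \<le> d a" "d' = d(a := d a - 2, b := d b + 1)"
    using assms(1) unfolding path_peb_move_def by auto
  have dv: "d v = 0" and L: "weight {1..<v} d v < 1" and R: "weight {v<..n} d v < 1"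
    using assms(2) by (auto simp: stuck_def)
  have "a \<noteq> v"
    using ab dv by auto
  have half: False if "b = v" "A = {1..<v} \<or> A = {v<..n}" "a \<in> A" for A
  proof -
    have "gap a v = 1"
      using ab that by (auto simp: path_adj_def gap_def)
    then have "1 \<le> weight A d v"
      using weight_member[of A a d v] that ab by auto
    then show False
      using L R that by auto
  qed
  have "b \<noteq> v"
  proof
    assume "b = v"
    then have "a \<in> {1..<v} \<or> a \<in> {v<..n}"
      using ab by (auto simp: path_adj_def)
    then show False
      using half[OF \<open>b = v\<close>] by blast
  qed
  have adj: "a \<in> {1..n}" "b \<in> {1..n}" "a \<noteq> b" "gap a v \<le> gap b v + 1"
    using ab by (auto simp: path_adj_def gap_def)
  show ?thesis
  proof (cases "a < v")
    case True
    then have "b < v"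
      using ab \<open>b \<noteq> v\<close> by (auto simp: path_adj_def)
    have "weight {1..<v} d' v \<le> weight {1..<v} d v"
      unfolding ab(3) by (rule weight_move_le) (use True \<open>b < v\<close> ab adj in auto)
    moreover have "weight {v<..n} d' v = weight {v<..n} d v"
      using True \<open>b < v\<close> ab by (intro weight_cong) auto
    ultimately show ?thesis
      using L R dv ab \<open>a \<noteq> v\<close> \<open>b \<noteq> v\<close> by (auto simp: stuck_def)
  next
    case False
    then have "b > v" "a > v"
      using ab \<open>a \<noteq> v\<close> \<open>b \<noteq> v\<close> by (auto simp: path_adj_def)
    have "weight {v<..n} d' v \<le> weight {v<..n} d v"
      unfolding ab(3) by (rule weight_move_le) (use \<open>a > v\<close> \<open>b > v\<close> ab adj in auto)
    moreover have "weight {1..<v} d' v = weight {1..<v} d v"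
      using \<open>a > v\<close> \<open>b > v\<close> ab by (intro weight_cong) auto
    ultimately show ?thesis
      using L R dv ab \<open>a \<noteq> v\<close> \<open>b \<noteq> v\<close> by (auto simp: stuck_def)
  qed
qed

lemma stuck_imp_not_pebblable:
  assumes "stuck n d v"
  shows "\<not> path_pebblable n d v"
proof
  assume "path_pebblable n d v"
  then obtain d' where d': "(path_peb_move n)\<^sup>*\<^sup>* d d'" "1 \<le> d' v"
    unfolding path_pebblable_def by auto
  from d'(1) assms have "stuck n d' v"
    by (induction rule: rtranclp_induct) (auto intro: stuck_move)
  then show False
    using d'(2) by (simp add: stuck_def)
qed

text \<open>Here \<open>f u\<close> is the neighbour of \<open>u\<close> one step closer to
  \<open>v\<close>. One pebble per vertex weighs less than 1, so some vertex of \<open>A\<close>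
  carries two; moving them towards \<open>v\<close> keeps the weight and lowers the number of
  pebbles in \<open>A\<close>. The process must therefore end, and it can end only by reaching
  \<open>v\<close>.\<close>

lemma pebblable_if_side_weight:
  assumes "finite A" "(\<Sum>u\<in>A. 1 / 2 ^ gap u v) < (1::real)"
    and step: "\<And>u. u \<in> A \<Longrightarrow> f u \<in> insert v A \<and> path_adj n u (f u) \<and> gap u v = gap (f u) v + 1"
    and "v \<notin> A" "1 \<le> weight A d v"
  shows "path_pebblable n d v"
  using assms(5)
proof (induction "sum d A" arbitrary: d rule: less_induct)
  case less
  have "\<exists>u\<in>A. 2 \<le> d u"
  proof (rule ccontr)
    assume "\<not> (\<exists>u\<in>A. 2 \<le> d u)"
    then have "weight A d v \<le> (\<Sum>u\<in>A. 1 / 2 ^ gap u v)"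
      unfolding weight_def by (intro sum_mono divide_right_mono) (auto simp: not_le less_Suc_eq numeral_2_eq_2)
    then show False
      using assms(2) less.prems by simp
  qed
  then obtain u where u: "u \<in> A" "2 \<le> d u"
    by auto
  define d' where "d' = d(u := d u - 2, f u := d (f u) + 1)"
  have move: "path_peb_move n d d'"
    unfolding path_peb_move_def d'_def using u step[of u] by blast
  have neq: "f u \<noteq> u"
    using step[of u] u by (auto simp: path_adj_def)
  show ?case
  proof (cases "f u = v")
    case True
    then have "1 \<le> d' v"
      by (simp add: d'_def)
    then show ?thesis
      using move unfolding path_pebblable_def by blast
  next
    case False
    then have fu: "f u \<in> A"
      using step[of u] u by auto
    have split: "sum g A = sum g (A - {u, f u}) + (g u + g (f u))" for g :: "nat \<Rightarrow> nat"
      using assms(1) u fu neq by (subst sum.subset_diff[of "{u, f u}" A]) auto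
    have "sum d' (A - {u, f u}) = sum d (A - {u, f u})"
      by (rule sum.cong) (auto simp: d'_def)
    then have "sum d' A < sum d A"
      using u neq by (simp add: split d'_def)
    moreover have "weight A d' v = weight A d v"
      using weight_move[where d=d and v=v, OF assms(1) u(1) fu neq[symmetric] u(2)] step[of u] u
      by (simp add: d'_def)
    ultimately have "path_pebblable n d' v"
      using less by simp
    then show ?thesis
      using move unfolding path_pebblable_def by (meson converse_rtranclp_into_rtranclp)
  qed
qed

text \<open>Distances to \<open>v\<close> turn vertex intervals on either side into intervals of
  naturals. The window estimates below ask only for such a bijection and so serve left and right
  alike.\<close>

lemma bij_betw_gap_left:
  assumes "b \<le> v"
  shows "bij_betw (\<lambda>u. gap u v) {a..<b} {v - b<..v - a}"
  by (rule bij_betwI[where g="\<lambda>k. v - k"]) (use assms in \<open>auto simp: gap_def\<close>)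

lemma bij_betw_gap_right:
  assumes "v \<le> a"
  shows "bij_betw (\<lambda>u. gap u v) {a<..b} {a - v<..b - v}"
  by (rule bij_betwI[where g="\<lambda>k. k + v"]) (use assms in \<open>auto simp: gap_def\<close>)

lemma sum_gap:
  assumes "bij_betw (\<lambda>u. gap u v) A {a<..b}" "a \<le> b"
  shows "(\<Sum>u\<in>A. 1 / 2 ^ gap u v) = 1 / 2 ^ a - 1 / (2::real) ^ b"
proof -
  have "(\<Sum>u\<in>A. 1 / 2 ^ gap u v) = (\<Sum>k\<in>{a<..b}. 1 / (2::real) ^ k)"
    using sum.reindex_bij_betw[OF assms(1), of "\<lambda>k. 1 / (2::real) ^ k"] .
  also have "\<dots> = 1 / 2 ^ a - 1 / 2 ^ b"
    using assms(2)
  proof (induction b rule: dec_induct)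
    case (step b)
    have "{a<..Suc b} = insert (Suc b) {a<..b}"
      using step by auto
    moreover have "1 / (2::real) ^ b = 2 * (1 / 2 ^ Suc b)"
      by simp
    ultimately show ?case
      using step.IH by (simp del: power_Suc)
  qed simp
  finally show ?thesis .
qed

lemma not_pebblable_imp_stuck:
  assumes "v \<in> {1..n}" "\<not> path_pebblable n d v"
  shows "stuck n d v"
proof -
  have "d v = 0"
    using assms(2) unfolding path_pebblable_def by (metis le_less_linear less_one rtranclp.rtrancl_refl)
  moreover have "weight {1..<v} d v < 1"
  proof (rule ccontr)
    assume "\<not> weight {1..<v} d v < 1"
    \<comment> \<open>One pebble on each vertex of this side weighs only
      \<open>1 - 1 / 2 ^ (v - 1)\<close>.\<close>
    moreover have "(\<Sum>u\<in>{1..<v}. 1 / 2 ^ gap u v) < (1::real)"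
      using sum_gap[OF bij_betw_gap_left[of v v 1]] by simp
    ultimately show False
      using assms pebblable_if_side_weight[of "{1..<v}" v Suc n d] by (force simp: path_adj_def gap_def)
  qed
  moreover have "weight {v<..n} d v < 1"
  proof (rule ccontr)
    assume "\<not> weight {v<..n} d v < 1"
    moreover have "(\<Sum>u\<in>{v<..n}. 1 / 2 ^ gap u v) < (1::real)"
      using sum_gap[OF bij_betw_gap_right[of v v n]] by simp
    ultimately show False
      using assms pebblable_if_side_weight[of "{v<..n}" v "\<lambda>u. u - 1" n d] by (force simp: path_adj_def gap_def)
  qed
  ultimately show ?thesis
    by (simp add: stuck_def)
qed

lemma path_solvable_iff: "path_solvable n d \<longleftrightarrow> (\<forall>v\<in>{1..n}. \<not> stuck n d v)"
  unfolding path_solvable_def using stuck_imp_not_pebblable not_pebblable_imp_stuck by blast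

subsection \<open>Monotonicity of the solvability probability\<close>

text \<open>Vanishing outside the path makes the set finite and loses no probability, since
  \<open>Pi_pmf\<close> with default value 0 is concentrated on such functions.\<close>

definition unsolvable_set :: "nat \<Rightarrow> (nat \<Rightarrow> nat) set" where
  "unsolvable_set n = {d. \<not> path_solvable n d \<and> (\<forall>u. u \<notin> {1..n} \<longrightarrow> d u = 0)}"

lemma stuck_antimono:
  assumes "stuck n d v" "\<And>u. d' u \<le> d u"
  shows "stuck n d' v"
proof -
  have "d' v = 0"
    using assms(1) assms(2)[of v] by (simp add: stuck_def)
  moreover have "weight {1..<v} d' v \<le> weight {1..<v} d v" "weight {v<..n} d' v \<le> weight {v<..n} d v"
    using assms(2) by (auto intro: weight_mono)
  ultimately show ?thesis
    using assms(1) by (auto simp: stuck_def)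
qed

lemma unsolvable_set_downward:
  assumes "d \<in> unsolvable_set n" "\<And>u. d' u \<le> d u"
  shows "d' \<in> unsolvable_set n"
proof -
  have "d' u = 0" if "u \<notin> {1..n}" for u
    using assms(1) assms(2)[of u] that by (auto simp: unsolvable_set_def)
  then show ?thesis
    using assms stuck_antimono[of n d _ d'] unfolding unsolvable_set_def path_solvable_iff by blast
qed

text \<open>A stuck vertex bounds every pile: \<open>d u / 2 ^ gap u v < 1\<close> and distances on
  the path are at most \<open>n\<close>.\<close>

lemma finite_unsolvable_set: "finite (unsolvable_set n)"
proof (rule finite_subset)
  show "unsolvable_set n \<subseteq> PiE_dflt {1..n} 0 (\<lambda>_. {..<2 ^ n})"
  proof
    fix d assume d: "d \<in> unsolvable_set n"
    then obtain v where v: "v \<in> {1..n}" "stuck n d v"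
      unfolding unsolvable_set_def path_solvable_iff by auto
    have "d u < 2 ^ n" if u: "u \<in> {1..n}" for u
    proof (cases "u = v")
      case True
      then show ?thesis
        using v by (simp add: stuck_def)
    next
      case False
      define A where "A = (if u < v then {1..<v} else {v<..n})"
      have "real (d u) / 2 ^ gap u v \<le> weight A d v"
        using u False by (intro weight_member) (auto simp: A_def)
      also have "\<dots> < 1"
        using v by (simp add: A_def stuck_def)
      finally have "real (d u) < 2 ^ gap u v"
        by simp
      also have "\<dots> \<le> 2 ^ n"
        using u v by (intro power_increasing) (auto simp: gap_def)
      finally have "real (d u) < real (2 ^ n)"
        by simp
      then show ?thesis
        by (simp only: of_nat_less_iff)
    qed
    then show "d \<in> PiE_dflt {1..n} 0 (\<lambda>_. {..<2 ^ n})"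
      using d by (auto simp: PiE_dflt_def unsolvable_set_def)
  qed
qed (auto intro!: finite_PiE_dflt)

lemma zero_in_unsolvable_set: "1 \<le> n \<Longrightarrow> (\<lambda>_. 0) \<in> unsolvable_set n"
  unfolding unsolvable_set_def path_solvable_iff
  by (auto simp: stuck_def weight_def intro!: bexI[of _ 1])

abbreviation geometric_pebbles :: "nat \<Rightarrow> real \<Rightarrow> (nat \<Rightarrow> nat) pmf" where
  "geometric_pebbles n q \<equiv> Pi_pmf {1..n} 0 (\<lambda>_. geometric_pmf q)"

lemma prob_not_path_solvable:
  "measure_pmf.prob (geometric_pebbles n q) {d. \<not> path_solvable n d} = 1 - path_solv_prob n q"
proof -
  have "measure_pmf.prob (geometric_pebbles n q) (UNIV - {d. path_solvable n d}) = 1 - path_solv_prob n q"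
    using measure_pmf.prob_compl[of "{d. path_solvable n d}" "geometric_pebbles n q"]
    by (simp add: path_solv_prob_def)
  moreover have "UNIV - {d. path_solvable n d} = {d. \<not> path_solvable n d}"
    by auto
  ultimately show ?thesis
    by simp
qed

text \<open>A distribution with \<open>k\<close> pebbles has probability
  \<open>q ^ n * (1 - q) ^ k\<close>. Summing over the finite set of unsolvable ones gives a
  polynomial in \<open>q\<close>, which can be differentiated.\<close>

lemma path_solv_prob_eq:
  assumes "0 < q" "q \<le> 1"
  shows "path_solv_prob n q = 1 - (\<Sum>d\<in>unsolvable_set n. q ^ n * (1 - q) ^ sum d {1..n})"
proof -
  let ?M = "Pi_pmf {1..n} 0 (\<lambda>_. geometric_pmf q)"
  have "measure_pmf.prob ?M {d. \<not> path_solvable n d} = measure_pmf.prob ?M (unsolvable_set n)"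
  proof (rule measure_prob_cong_0)
    fix d assume "d \<in> {d. \<not> path_solvable n d} - unsolvable_set n"
    then show "pmf ?M d = 0"
      by (intro pmf_Pi_outside) (auto simp: unsolvable_set_def)
  qed (auto simp: unsolvable_set_def)
  also have "\<dots> = (\<Sum>d\<in>unsolvable_set n. pmf ?M d)"
    by (rule measure_measure_pmf_finite[OF finite_unsolvable_set])
  also have "\<dots> = (\<Sum>d\<in>unsolvable_set n. q ^ n * (1 - q) ^ sum d {1..n})"
  proof (rule sum.cong)
    fix d assume "d \<in> unsolvable_set n"
    then show "pmf ?M d = q ^ n * (1 - q) ^ sum d {1..n}"
      using assms by (subst pmf_Pi')
        (auto simp: unsolvable_set_def prod.distrib power_sum)
  qed simp
  finally have "measure_pmf.prob ?M {d. \<not> path_solvable n d} =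
    (\<Sum>d\<in>unsolvable_set n. q ^ n * (1 - q) ^ sum d {1..n})" .
  then show ?thesis
    unfolding prob_not_path_solvable by linarith
qed

text \<open>Along each coordinate direction the sum telescopes up to the boundary of the down-set.\<close>

lemma down_set_shift_sum_less:
  fixes U :: "('a \<Rightarrow> nat) set"
  assumes "finite U" "(\<lambda>_. 0) \<in> U" "finite A" "i \<in> A" "0 < (p::real)"
    and down: "\<And>d. d \<in> U \<Longrightarrow> d(i := d i - 1) \<in> U"
  shows "(\<Sum>d\<in>U. real (d i) * p ^ sum d A) < (\<Sum>d\<in>U. real (d i + 1) * p ^ (sum d A + 1))"
proof -
  define \<sigma> :: "('a \<Rightarrow> nat) \<Rightarrow> 'a \<Rightarrow> nat" where "\<sigma> d = d(i := d i + 1)" for d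
  have inj: "inj \<sigma>"
  proof (rule injI)
    fix d e assume eq: "\<sigma> d = \<sigma> e"
    show "d = e"
    proof
      fix x show "d x = e x"
        using fun_cong[OF eq, of x] by (auto simp: \<sigma>_def split: if_splits)
    qed
  qed
  have sumA: "sum (\<sigma> d) A = sum d A + 1" for d
    using assms(3,4) by (simp add: \<sigma>_def sum.remove[of A i])
  \<comment> \<open>An injective self-map of the finite set \<open>U\<close> would be onto, but the
    zero function is no value of \<open>\<sigma>\<close>. Hence some shifted element leaves
    \<open>U\<close>; it makes the inequality strict.\<close>
  have "\<not> \<sigma> ` U \<subseteq> U"
  proof
    assume "\<sigma> ` U \<subseteq> U"
    then have "\<sigma> ` U = U"
      using assms(1) inj by (intro card_subset_eq) (auto simp: card_image inj_on_subset)
    then obtain d where "(\<lambda>_. 0) = \<sigma> d"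
      using assms(2) by blast
    then have "0 = \<sigma> d i"
      by metis
    then show False
      by (simp add: \<sigma>_def)
  qed
  then obtain e where e: "e \<in> \<sigma> ` U" "e \<notin> U"
    by auto
  \<comment> \<open>Terms with \<open>d i = 0\<close> vanish, and by downward closure every other
    element of \<open>U\<close> is a shift of an element of \<open>U\<close>.\<close>
  have "(\<Sum>d\<in>U. real (d i) * p ^ sum d A) = (\<Sum>d\<in>U \<inter> \<sigma> ` U. real (d i) * p ^ sum d A)"
  proof (rule sum.mono_neutral_right)
    show "\<forall>d\<in>U - U \<inter> \<sigma> ` U. real (d i) * p ^ sum d A = 0"
    proof
      fix d assume d: "d \<in> U - U \<inter> \<sigma> ` U"
      have "d i = 0"
      proof (rule ccontr)
        assume "d i \<noteq> 0"
        then have "d = \<sigma> (d(i := d i - 1))"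
          by (auto simp: \<sigma>_def)
        then show False
          using d down[of d] by blast
      qed
      then show "real (d i) * p ^ sum d A = 0"
        by simp
    qed
  qed (use assms in auto)
  also have "\<dots> < (\<Sum>d\<in>\<sigma> ` U. real (d i) * p ^ sum d A)"
  proof (rule sum_strict_mono2[of _ _ e])
    show "0 < real (e i) * p ^ sum e A"
      using e assms(5) by (auto simp: \<sigma>_def)
  qed (use assms e in auto)
  also have "\<dots> = (\<Sum>d\<in>U. real (d i + 1) * p ^ (sum d A + 1))"
    using inj_on_subset[OF inj subset_UNIV, of U] by (subst sum.reindex) (auto simp: sumA, auto simp: \<sigma>_def)
  finally show ?thesis .
qed

section \<open>Sign of the derivative and uniqueness of the threshold\<close>

text \<open>With \<open>p = 1 - q\<close>, the sign of the derivative is that of the sum of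
  \<open>k * p ^ k - (n + k) * p ^ (k + 1)\<close> over the down-set, \<open>k\<close> being the
  number of pebbles. This splits into one telescoping inequality per coordinate.\<close>

lemma DERIV_unsolvable_sum:
  fixes p :: real
  assumes "0 < p" "p < 1" "1 \<le> n"
  shows "\<exists>y. ((\<lambda>p. \<Sum>d\<in>unsolvable_set n. (1 - p) ^ n * p ^ sum d {1..n}) has_real_derivative y) (at p) \<and> y < 0"
proof -
  let ?U = "unsolvable_set n" and ?k = "\<lambda>d :: nat \<Rightarrow> nat. sum d {1..n}"
  define y where "y = (\<Sum>d\<in>?U. - real n * (1 - p) ^ (n - 1) * p ^ ?k d + (1 - p) ^ n * (real (?k d) * p ^ (?k d - 1)))"
  have "((\<lambda>p. \<Sum>d\<in>?U. (1 - p) ^ n * p ^ ?k d) has_real_derivative y) (at p)"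
    unfolding y_def by (rule DERIV_sum) (auto intro!: derivative_eq_intros simp: algebra_simps)
  \<comment> \<open>Multiplying by \<open>p > 0\<close> keeps the sign and removes the exponent
    \<open>k - 1\<close>, which is truncated at \<open>k = 0\<close>.\<close>
  moreover have "y * p = (1 - p) ^ (n - 1) * (\<Sum>d\<in>?U. real (?k d) * p ^ ?k d - (real n + real (?k d)) * p ^ (?k d + 1))"
  proof -
    have "(- real n * (1 - p) ^ (n - 1) * p ^ k + (1 - p) ^ n * (real k * p ^ (k - 1))) * p
      = (1 - p) ^ (n - 1) * (real k * p ^ k - (real n + real k) * p ^ (k + 1))" for k
    proof -
      obtain j where j: "n = Suc j"
        using assms(3) by (cases n) auto
      show ?thesis
        unfolding j by (cases k) (auto simp: algebra_simps)
    qed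
    then show ?thesis
      unfolding y_def sum_distrib_left sum_distrib_right by (intro sum.cong refl)
  qed
  moreover have "(\<Sum>d\<in>?U. real (?k d) * p ^ ?k d - (real n + real (?k d)) * p ^ (?k d + 1)) < 0"
  proof -
    have "(\<Sum>d\<in>?U. real (?k d) * p ^ ?k d) = (\<Sum>i=1..n. \<Sum>d\<in>?U. real (d i) * p ^ ?k d)"
      by (subst sum.swap) (simp add: sum_distrib_right)
    also have "\<dots> < (\<Sum>i=1..n. \<Sum>d\<in>?U. real (d i + 1) * p ^ (?k d + 1))"
    proof (rule sum_strict_mono)
      fix i assume "i \<in> {1..n}"
      then show "(\<Sum>d\<in>?U. real (d i) * p ^ ?k d) < (\<Sum>d\<in>?U. real (d i + 1) * p ^ (?k d + 1))"
        using assms by (intro down_set_shift_sum_less finite_unsolvable_set zero_in_unsolvable_set)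
          (auto elim!: unsolvable_set_downward)
    qed (use assms in auto)
    \<comment> \<open>Adding \<open>d i + 1\<close> over all \<open>n\<close> coordinates gives
      \<open>n + k\<close>.\<close>
    also have "\<dots> = (\<Sum>d\<in>?U. (real n + real (?k d)) * p ^ (?k d + 1))"
      by (subst sum.swap, simp only: sum_distrib_right[symmetric]) (simp add: sum.distrib)
    finally show ?thesis
      by (simp add: sum_subtractf)
  qed
  ultimately have "((\<lambda>p. \<Sum>d\<in>?U. (1 - p) ^ n * p ^ ?k d) has_real_derivative y) (at p)" "y * p < 0"
    using assms by (auto simp: mult_pos_neg)
  then show ?thesis
    using assms by (auto simp: mult_less_0_iff)
qed

lemma path_solv_prob_strict_antimono:
  assumes "0 < q" "q < q'" "q' < 1" "1 \<le> n"
  shows "path_solv_prob n q' < path_solv_prob n q"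
proof -
  have "(\<Sum>d\<in>unsolvable_set n. (1 - (1 - q')) ^ n * (1 - q') ^ sum d {1..n}) >
    (\<Sum>d\<in>unsolvable_set n. (1 - (1 - q)) ^ n * (1 - q) ^ sum d {1..n})"
    by (rule DERIV_neg_imp_decreasing[where f="\<lambda>p. \<Sum>d\<in>unsolvable_set n. (1 - p) ^ n * p ^ sum d {1..n}"])
      (use assms DERIV_unsolvable_sum in auto)
  then show ?thesis
    using assms by (simp add: path_solv_prob_eq)
qed

lemma continuous_on_path_solv_prob: "continuous_on {0<..1} (path_solv_prob n)"
proof -
  have "continuous_on {0<..1} (\<lambda>q. 1 - (\<Sum>d\<in>unsolvable_set n. q ^ n * (1 - q :: real) ^ sum d {1..n}))"
    by (intro continuous_intros)
  then show ?thesis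
    by (subst continuous_on_cong[OF refl path_solv_prob_eq]) auto
qed

text \<open>The numbers \<open>a\<close> and \<open>b\<close> are mean pebbles per vertex. The
  intermediate value theorem gives a solution between \<open>a * n\<close> and \<open>b * n\<close>,
  and strict monotonicity makes it the only positive one, so it is the value of the
  \<open>THE\<close>.\<close>

lemma geom_threshold_path_between:
  assumes "1 \<le> n" "0 < a" "a < b"
    and a: "path_solv_prob n (inverse (1 + a)) < 1 / 2"
    and b: "1 / 2 < path_solv_prob n (inverse (1 + b))"
  shows "a * real n < geom_threshold_path n \<and> geom_threshold_path n < b * real n"
proof -
  let ?f = "\<lambda>x. path_solv_prob n (inverse (1 + x / real n))"
  have less: "?f x < ?f y" if "0 < x" "x < y" for x y
  proof (rule path_solv_prob_strict_antimono)
    have "x / real n < y / real n" "0 < x / real n"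
      using that assms by (auto simp: divide_strict_right_mono)
    then show "0 < inverse (1 + y / real n)" "inverse (1 + y / real n) < inverse (1 + x / real n)"
      "inverse (1 + x / real n) < 1"
      by (auto simp: field_simps)
  qed (use assms in auto)
  have "continuous_on {a * real n..b * real n} ?f"
  proof (rule continuous_on_compose2[OF continuous_on_path_solv_prob])
    have pos: "0 \<le> x / real n" if "x \<in> {a * real n..b * real n}" for x
      using that assms by (auto intro!: divide_nonneg_nonneg intro: order_trans[of 0 "a * real n"])
    then show "continuous_on {a * real n..b * real n} (\<lambda>x. inverse (1 + x / real n))"
      using assms by (intro continuous_intros) force+
    show "(\<lambda>x. inverse (1 + x / real n)) ` {a * real n..b * real n} \<subseteq> {0<..1}"
      using pos by (auto simp: field_simps add_pos_nonneg intro!: inverse_le_1_iff[THEN iffD2])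
  qed
  then obtain x where x: "a * real n \<le> x" "x \<le> b * real n" "?f x = 1 / 2"
    using IVT'[of ?f "a * real n" "1/2" "b * real n"] assms by (auto simp: less_imp_le)
  have x0: "0 < x"
    using x assms by (auto intro: less_le_trans[of 0 "a * real n"])
  have "geom_threshold_path n = x"
    unfolding geom_threshold_path_def
  proof (rule the_equality)
    fix y assume y: "0 < y \<and> ?f y = 1 / 2"
    show "y = x"
      using less[of x y] less[of y x] x x0 y by (cases x y rule: linorder_cases) auto
  qed (use x x0 in auto)
  moreover have "x \<noteq> a * real n" "x \<noteq> b * real n"
    using x assms by auto
  ultimately show ?thesis
    using x by auto
qed

subsection \<open>Weighted sums of independent geometric variables\<close>

lemma measure_pair_pmf_prod:
  "measure_pmf.prob (pair_pmf M N) (A \<times> B) = measure_pmf.prob M A * measure_pmf.prob N B"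
proof -
  \<comment> \<open>Cutting down to the countable supports changes no probability and reduces the
    claim to countable events.\<close>
  have "measure_pmf.prob (pair_pmf M N) (A \<times> B)
      = measure_pmf.prob (pair_pmf M N) ((A \<inter> set_pmf M) \<times> (B \<inter> set_pmf N))"
    by (subst measure_Int_set_pmf[symmetric]) (simp add: Times_Int_Times)
  also have "\<dots> = measure_pmf.prob M (A \<inter> set_pmf M) * measure_pmf.prob N (B \<inter> set_pmf N)"
    by (intro measure_pmf_prob_product) auto
  finally show ?thesis
    by (simp add: measure_Int_set_pmf)
qed

text \<open>The last two hypotheses say that \<open>P\<close> sees only coordinates in
  \<open>S\<close> and \<open>Q\<close> only those in \<open>T\<close>. The product is split into
  the factors over \<open>S\<close> and over \<open>A - S\<close>, which \<open>h\<close> glues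
  together again.\<close>

lemma prob_Pi_pmf_indep:
  assumes "finite A" "S \<subseteq> A" "T \<subseteq> A" "S \<inter> T = {}"
    and P: "\<And>d e. (\<And>u. u \<in> S \<Longrightarrow> d u = e u) \<Longrightarrow> P d = P e"
    and Q: "\<And>d e. (\<And>u. u \<in> T \<Longrightarrow> d u = e u) \<Longrightarrow> Q d = Q e"
  shows "measure_pmf.prob (Pi_pmf A z p) {d. P d \<and> Q d} =
    measure_pmf.prob (Pi_pmf A z p) {d. P d} * measure_pmf.prob (Pi_pmf A z p) {d. Q d}"
proof -
  let ?M = "Pi_pmf S z p" and ?N = "Pi_pmf (A - S) z p"
  define h where "h = (\<lambda>(f, g) x. if x \<in> S then f x else g x :: 'b)"
  have A: "Pi_pmf A z p = map_pmf h (pair_pmf ?M ?N)"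
    using assms Pi_pmf_union[of S "A - S" z p] by (auto simp: h_def Un_absorb1 finite_subset)
  have PQ: "P (h (f, g)) = P f" "Q (h (f, g)) = Q g" for f g
    using assms(4) by (auto simp: h_def intro!: P Q)
  have prod: "measure_pmf.prob (Pi_pmf A z p) {d. P d \<and> R d}
      = measure_pmf.prob ?M {d. P d} * measure_pmf.prob ?N {d. R d}"
    if R: "\<And>f g. R (h (f, g)) = R g" for R
  proof -
    have "h -` {d. P d \<and> R d} = {d. P d} \<times> {d. R d}"
      by (auto simp: PQ R)
    then show ?thesis
      unfolding A measure_map_pmf by (simp only: measure_pair_pmf_prod)
  qed
  have "h -` {d. Q d} = UNIV \<times> {d. Q d}"
    by (auto simp: PQ)
  then have "measure_pmf.prob (Pi_pmf A z p) {d. Q d} = measure_pmf.prob ?N {d. Q d}"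
    unfolding A measure_map_pmf by (simp only: measure_pair_pmf_prod) simp
  then show ?thesis
    using prod[of Q] prod[of "\<lambda>_. True"] PQ(2) by simp
qed

lemma prob_Pi_pmf_indep_family:
  assumes "finite A" "finite I" "\<And>i. i \<in> I \<Longrightarrow> K i \<subseteq> A" "disjoint_family_on K I"
    and P: "\<And>i d e. i \<in> I \<Longrightarrow> (\<And>u. u \<in> K i \<Longrightarrow> d u = e u) \<Longrightarrow> P i d = P i e"
  shows "measure_pmf.prob (Pi_pmf A z p) {d. \<forall>i\<in>I. P i d} =
    (\<Prod>i\<in>I. measure_pmf.prob (Pi_pmf A z p) {d. P i d})"
  using assms(2-5)
proof (induction I rule: finite_induct)
  case (insert j I)
  have "measure_pmf.prob (Pi_pmf A z p) {d. P j d \<and> (\<forall>i\<in>I. P i d)} =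
    measure_pmf.prob (Pi_pmf A z p) {d. P j d} * measure_pmf.prob (Pi_pmf A z p) {d. \<forall>i\<in>I. P i d}"
  proof (rule prob_Pi_pmf_indep[OF assms(1)])
    show "K j \<subseteq> A" "(\<Union>i\<in>I. K i) \<subseteq> A"
      using insert.prems by auto
    show "K j \<inter> (\<Union>i\<in>I. K i) = {}"
      using insert.prems(2) insert.hyps unfolding disjoint_family_on_def by auto
    show "P j d = P j e" if "\<And>u. u \<in> K j \<Longrightarrow> d u = e u" for d e
      using that insert.prems(3) by blast
    show "(\<forall>i\<in>I. P i d) = (\<forall>i\<in>I. P i e)" if "\<And>u. u \<in> (\<Union>i\<in>I. K i) \<Longrightarrow> d u = e u" for d e
    proof (rule ball_cong[OF refl])
      fix i assume "i \<in> I"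
      then show "P i d = P i e"
        using that by (intro insert.prems(3)) auto
    qed
  qed
  moreover have "measure_pmf.prob (Pi_pmf A z p) {d. \<forall>i\<in>I. P i d} =
    (\<Prod>i\<in>I. measure_pmf.prob (Pi_pmf A z p) {d. P i d})"
  proof (rule insert.IH)
    show "disjoint_family_on K I"
      using insert.prems(2) by (rule disjoint_family_on_mono[rotated]) auto
    show "P i d = P i e" if "i \<in> I" "\<And>u. u \<in> K i \<Longrightarrow> d u = e u" for i d e
      using that by (intro insert.prems(3)) auto
  qed (use insert.prems(1) in auto)
  ultimately show ?case
    using insert.hyps by simp
qed simp

section \<open>Exponential moments and Markov bounds\<close>

text \<open>The exact value is \<open>q / (1 - c)\<close> with
  \<open>c = (1 - q) * exp (- a)\<close>; dropping the factor \<open>1 - q\<close> and using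
  \<open>exp (- a) \<le> 1 / (1 + a)\<close> gives a bound that is linear in
  \<open>q\<close>.\<close>

lemma expectation_exp_geometric_pmf:
  fixes a :: real
  assumes "0 < q" "q \<le> 1" "0 < a"
  shows "integrable (measure_pmf (geometric_pmf q)) (\<lambda>k. exp (- a * real k))"
    and "measure_pmf.expectation (geometric_pmf q) (\<lambda>k. exp (- a * real k)) \<le> q * (1 + 1 / a)"
proof -
  show int: "integrable (measure_pmf (geometric_pmf q)) (\<lambda>k. exp (- a * real k))"
    using assms by (intro measure_pmf.integrable_const_bound[where B=1]) auto
  define c where "c = (1 - q) * exp (- a)"
  have "exp (- a) < 1"
    using assms by simp
  have c: "0 \<le> c" "c \<le> exp (- a)"
    using assms by (auto simp: c_def mult_left_le_one_le)
  have eq: "(1 - q) ^ k * q * exp (- a * real k) = q * c ^ k" for k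
    by (simp add: c_def power_mult_distrib exp_of_nat_mult[symmetric] mult_ac)
  have "(\<lambda>k. q * c ^ k) sums (q * (1 / (1 - c)))"
    using c order_le_less_trans[OF c(2) \<open>exp (- a) < 1\<close>] by (intro sums_mult geometric_sums) auto
  then have s: "(\<lambda>k. (1 - q) ^ k * q * exp (- a * real k)) sums (q * (1 / (1 - c)))"
    by (simp only: eq)
  have "measure_pmf.expectation (geometric_pmf q) (\<lambda>k. exp (- a * real k))
      = (\<integral>k. pmf (geometric_pmf q) k * exp (- a * real k) \<partial>count_space UNIV)"
    unfolding measure_pmf_eq_density by (subst integral_density) auto
  also have "\<dots> = q * (1 / (1 - c))"
  proof -
    have "integrable (count_space UNIV) (\<lambda>k. pmf (geometric_pmf q) k * exp (- a * real k))"
      using s assms unfolding integrable_count_space_nat_iff by (simp add: sums_iff abs_mult)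
    then show ?thesis
      using s assms by (subst integral_count_space_nat) (simp_all add: sums_iff)
  qed
  also have "\<dots> \<le> q * (1 + 1 / a)"
  proof -
    have "exp (- a) \<le> 1 / (1 + a)"
      using exp_ge_add_one_self[of a] assms by (simp add: exp_minus field_simps)
    then have "c \<le> 1 / (1 + a)"
      using c by simp
    then have "a / (1 + a) \<le> 1 - c"
      using assms by (simp add: field_simps)
    then have "1 / (1 - c) \<le> 1 / (a / (1 + a))"
      using assms order_le_less_trans[OF c(2) \<open>exp (- a) < 1\<close>] by (intro divide_left_mono mult_pos_pos) auto
    also have "\<dots> = 1 + 1 / a"
      using assms by (simp add: field_simps)
    finally show ?thesis
      using assms by (intro mult_left_mono) auto
  qed
  finally show "measure_pmf.expectation (geometric_pmf q) (\<lambda>k. exp (- a * real k)) \<le> q * (1 + 1 / a)" .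
qed

text \<open>Exponential moment method: Markov's inequality for \<open>exp (- t * W)\<close>, with
  \<open>W\<close> the weighted sum, whose expectation factorises over the independent
  coordinates.\<close>

lemma prob_weighted_sum_less_upper:
  fixes w :: "'a \<Rightarrow> real"
  assumes "finite A" "S \<subseteq> A" "0 < q" "q \<le> 1" "0 < t" and w: "\<And>u. u \<in> S \<Longrightarrow> 0 < w u"
  shows "measure_pmf.prob (Pi_pmf A 0 (\<lambda>_. geometric_pmf q)) {d. (\<Sum>u\<in>S. w u * real (d u)) < 1}
    \<le> exp t * (\<Prod>u\<in>S. q * (1 + 1 / (t * w u)))"
proof -
  let ?M = "Pi_pmf A 0 (\<lambda>_. geometric_pmf q)"
  \<comment> \<open>The value 1 outside \<open>S\<close> lets the product run over all of
    \<open>A\<close>, where the product formula for expectations applies.\<close>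
  define f :: "'a \<Rightarrow> nat \<Rightarrow> real" where "f u k = (if u \<in> S then exp (- (t * w u) * real k) else 1)" for u k
  have prodf: "(\<Prod>u\<in>A. f u (d u)) = exp (- t * (\<Sum>u\<in>S. w u * real (d u)))" for d
  proof -
    have "(\<Prod>u\<in>A. f u (d u)) = (\<Prod>u\<in>S. exp (- (t * w u) * real (d u)))"
      using assms(1,2) by (intro prod.mono_neutral_cong_right) (auto simp: f_def)
    also have "\<dots> = exp (\<Sum>u\<in>S. - (t * w u) * real (d u))"
      using assms finite_subset by (subst exp_sum) auto
    also have "(\<Sum>u\<in>S. - (t * w u) * real (d u)) = - t * (\<Sum>u\<in>S. w u * real (d u))"
      by (simp add: sum_distrib_left mult_ac sum_negf)
    finally show ?thesis .
  qed
  have intf: "integrable (measure_pmf (geometric_pmf q)) (f u)" for u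
    using expectation_exp_geometric_pmf(1)[of q "t * w u"] assms by (cases "u \<in> S") (auto simp: f_def[abs_def])
  have int: "integrable (measure_pmf ?M) (\<lambda>d. \<Prod>u\<in>A. f u (d u))"
    using assms intf by (intro integrable_prod_Pi_pmf) auto
  have "measure_pmf.prob ?M {d. (\<Sum>u\<in>S. w u * real (d u)) < 1}
      \<le> measure_pmf.prob ?M {d \<in> space (measure_pmf ?M). (\<Prod>u\<in>A. f u (d u)) \<ge> exp (- t)}"
    using assms by (intro measure_pmf.finite_measure_mono) (auto simp: prodf mult_le_cancel_left1)
  also have "\<dots> \<le> measure_pmf.expectation ?M (\<lambda>d. \<Prod>u\<in>A. f u (d u)) / exp (- t)"
    using int by (intro integral_Markov_inequality_measure[where A = UNIV]) (auto simp: prodf)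
  also have "\<dots> = exp t * (\<Prod>u\<in>A. measure_pmf.expectation (geometric_pmf q) (f u))"
    using assms intf by (subst expectation_prod_Pi_pmf) (auto simp: f_def exp_minus field_simps)
  also have "(\<Prod>u\<in>A. measure_pmf.expectation (geometric_pmf q) (f u))
      = (\<Prod>u\<in>S. measure_pmf.expectation (geometric_pmf q) (\<lambda>k. exp (- (t * w u) * real k)))"
    using assms(1,2) by (intro prod.mono_neutral_cong_right) (auto simp: f_def[abs_def])
  also have "\<dots> \<le> (\<Prod>u\<in>S. q * (1 + 1 / (t * w u)))"
    using assms by (intro prod_mono conjI expectation_exp_geometric_pmf(2)) (auto intro!: Bochner_Integration.integral_nonneg)
  finally show ?thesis
    by simp
qed

lemma prob_geometric_component:
  assumes "finite A" "u \<in> A"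
  shows "measure_pmf.prob (Pi_pmf A 0 (\<lambda>_. geometric_pmf q)) {d. P (d u)}
    = measure_pmf.prob (geometric_pmf q) {k. P k}"
proof -
  have "measure_pmf.prob (map_pmf (\<lambda>d. d u) (Pi_pmf A 0 (\<lambda>_. geometric_pmf q))) {k. P k}
      = measure_pmf.prob (geometric_pmf q) {k. P k}"
    using assms by (simp only: Pi_pmf_component if_True)
  then show ?thesis
    by (simp add: vimage_def)
qed

lemma prob_geometric_component_eq:
  assumes "finite A" "u \<in> A" "0 < q" "q \<le> 1"
  shows "measure_pmf.prob (Pi_pmf A 0 (\<lambda>_. geometric_pmf q)) {d. d u = k} = (1 - q) ^ k * q"
proof -
  have "{j. j = k} = {k}"
    by auto
  then show ?thesis
    using prob_geometric_component[OF assms(1,2), of q "\<lambda>j. j = k"] assms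
    by (simp add: measure_pmf_single)
qed

text \<open>Markov's inequality; \<open>l = (1 - q) / q\<close> is the mean of each
  coordinate.\<close>

lemma prob_weighted_sum_ge:
  fixes w :: "'a \<Rightarrow> real"
  assumes "finite A" "S \<subseteq> A" "0 < l" "0 < c" and w: "\<And>u. u \<in> S \<Longrightarrow> 0 \<le> w u"
  shows "measure_pmf.prob (Pi_pmf A 0 (\<lambda>_. geometric_pmf (inverse (1 + l)))) {d. c \<le> (\<Sum>u\<in>S. w u * real (d u))}
    \<le> l * sum w S / c"
proof -
  let ?q = "inverse (1 + l)"
  let ?M = "Pi_pmf A 0 (\<lambda>_. geometric_pmf ?q)"
  have q: "?q \<in> {0<..1}"
    using assms(3) by (auto simp: field_simps)
  have comp: "map_pmf (\<lambda>d. d u) ?M = geometric_pmf ?q" if "u \<in> S" for u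
    using that assms by (subst Pi_pmf_component) auto
  have int: "integrable (measure_pmf ?M) (\<lambda>d. real (d u))"
    and E: "measure_pmf.expectation ?M (\<lambda>d. real (d u)) = l" if "u \<in> S" for u
  proof -
    have "integrable (measure_pmf (map_pmf (\<lambda>d. d u) ?M)) real"
      unfolding comp[OF that] using q by (rule integrable_real_geometric_pmf)
    then show "integrable (measure_pmf ?M) (\<lambda>d. real (d u))"
      by simp
    have "measure_pmf.expectation (map_pmf (\<lambda>d. d u) ?M) real = (1 - ?q) / ?q"
      unfolding comp[OF that] using q by (rule expectation_geometric_pmf)
    also have "\<dots> = l"
      using assms(3) by (simp add: field_simps)
    finally show "measure_pmf.expectation ?M (\<lambda>d. real (d u)) = l"
      by simp
  qed
  have "measure_pmf.prob ?M {d \<in> space (measure_pmf ?M). c \<le> (\<Sum>u\<in>S. w u * real (d u))}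
      \<le> measure_pmf.expectation ?M (\<lambda>d. \<Sum>u\<in>S. w u * real (d u)) / c"
    using assms int by (intro integral_Markov_inequality_measure[where A = UNIV])
      (auto intro!: sum_nonneg)
  also have "measure_pmf.expectation ?M (\<lambda>d. \<Sum>u\<in>S. w u * real (d u)) = (\<Sum>u\<in>S. w u * l)"
    using int E by (subst Bochner_Integration.integral_sum) auto
  also have "\<dots> = l * sum w S"
    by (simp add: sum_distrib_left mult.commute)
  finally show ?thesis
    by simp
qed

section \<open>Lattice points and the volume of a simplex\<close>

text \<open>The left side is the integral of \<open>y ^ s\<close> over \<open>[0, a]\<close> divided
  by \<open>w\<close>; the right side, times \<open>w\<close>, is an upper Riemann sum of it with
  nodes \<open>a\<close>, \<open>a - w\<close>, \<open>a - 2 * w\<close> and so on.\<close>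

lemma riemann_sum_power_ge:
  fixes a w :: real
  assumes "0 < w" "0 < a"
  shows "a ^ Suc s / (real (Suc s) * w) \<le> (\<Sum>x | real x * w < a. (a - real x * w) ^ s)"
proof -
  \<comment> \<open>One cell of the sum: the increment of \<open>y ^ Suc s\<close> is at most the
    cell width times the derivative at the right end. The maximum with 0 treats the last, shorter
    cell.\<close>
  have conv: "y ^ Suc s - max 0 (y - w) ^ Suc s \<le> real (Suc s) * w * y ^ s" if "0 < y" for y
  proof -
    define z where "z = max 0 (y - w)"
    have z: "0 \<le> z" "z \<le> y" "y - z \<le> w"
      using that assms by (auto simp: z_def)
    have "y ^ Suc s - z ^ Suc s = (y - z) * (\<Sum>i<Suc s. z ^ (s - i) * y ^ i)"
      by (subst power_diff_sumr2) simp
    also have "\<dots> \<le> w * (\<Sum>i<Suc s. y ^ s)"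
    proof (intro mult_mono sum_mono)
      fix i assume "i \<in> {..<Suc s}"
      then have "y ^ s = y ^ (s - i) * y ^ i"
        by (simp add: power_add[symmetric])
      then show "z ^ (s - i) * y ^ i \<le> y ^ s"
        using z that by (simp add: mult_right_mono power_mono)
    qed (use z that assms in \<open>auto intro!: sum_nonneg add_nonneg_nonneg\<close>)
    finally show ?thesis
      by (simp add: z_def mult_ac)
  qed
  define g where "g x = max 0 (a - real x * w) ^ Suc s" for x :: nat
  have step: "g x - g (Suc x) \<le> real (Suc s) * w * (if real x * w < a then (a - real x * w) ^ s else 0)" for x
  proof (cases "real x * w < a")
    case True
    then show ?thesis
      using conv[of "a - real x * w"] by (simp add: g_def algebra_simps max_def)
  next
    case False
    then have "a - real (Suc x) * w \<le> 0" "a - real x * w \<le> 0"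
      using assms by (auto simp: algebra_simps)
    then show ?thesis
      using False by (simp add: g_def max_def)
  qed
  \<comment> \<open>The first multiple of \<open>w\<close> to reach \<open>a\<close>, so that
    \<open>g N = 0\<close> and the telescoping sum is complete.\<close>
  define N where "N = nat \<lceil>a / w\<rceil>"
  have N: "a \<le> real N * w"
  proof -
    have "a / w \<le> real N"
      unfolding N_def using assms by (simp add: real_nat_ceiling_ge)
    then show ?thesis
      using assms by (simp add: field_simps)
  qed
  have sub: "{x. real x * w < a} \<subseteq> {..<N}"
  proof
    fix x assume "x \<in> {x. real x * w < a}"
    then have "real x * w < real N * w"
      using N by simp
    then show "x \<in> {..<N}"
      using assms by simp
  qed
  have "a ^ Suc s = g 0 - g N"
    using N assms by (simp add: g_def max_def)
  also have "\<dots> = (\<Sum>x<N. g x - g (Suc x))"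
    by (simp add: sum_lessThan_telescope')
  also have "\<dots> \<le> (\<Sum>x<N. real (Suc s) * w * (if real x * w < a then (a - real x * w) ^ s else 0))"
    by (intro sum_mono step)
  also have "\<dots> = real (Suc s) * w * (\<Sum>x<N. if real x * w < a then (a - real x * w) ^ s else 0)"
    by (simp add: sum_distrib_left)
  also have "(\<Sum>x<N. if real x * w < a then (a - real x * w) ^ s else 0) = (\<Sum>x | real x * w < a. (a - real x * w) ^ s)"
    using sub by (intro sum.mono_neutral_cong_right) auto
  finally have "a ^ Suc s \<le> (\<Sum>x | real x * w < a. (a - real x * w) ^ s) * (real (Suc s) * w)"
    by (simp only: mult.commute)
  moreover have "0 < real (Suc s) * w"
    using assms by simp
  ultimately show ?thesis
    by (simp only: pos_divide_le_eq)
qed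

lemma finite_multiples_less:
  fixes a w :: real
  assumes "0 < w"
  shows "finite {x::nat. real x * w < a}"
proof (rule finite_subset)
  show "{x::nat. real x * w < a} \<subseteq> {..nat \<lceil>a / w\<rceil>}"
  proof
    fix x :: nat assume "x \<in> {x. real x * w < a}"
    then have "real x < a / w"
      using assms by (simp add: field_simps)
    then show "x \<in> {..nat \<lceil>a / w\<rceil>}"
      by (simp add: le_nat_iff) linarith
  qed
qed simp

text \<open>Up to the factor \<open>q ^ card S * exp (- c * a)\<close>, which bounds the point masses from below,
  this is the volume of the simplex \<open>{x. (\<Sum>u\<in>S. w u * x u) < a}\<close>: the unit cubes attached to its
  lattice points cover it.\<close>

lemma prob_weighted_sum_less_lower:
  fixes w :: "'a \<Rightarrow> real"
  assumes "finite A" "S \<subseteq> A" "0 < q" "q \<le> 1" "0 < a" "0 \<le> c"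
    and w: "\<And>u. u \<in> S \<Longrightarrow> 0 < w u \<and> exp (- c * w u) \<le> 1 - q"
  shows "q ^ card S * exp (- c * a) * a ^ card S / (fact (card S) * (\<Prod>u\<in>S. w u))
    \<le> measure_pmf.prob (Pi_pmf A 0 (\<lambda>_. geometric_pmf q)) {d. (\<Sum>u\<in>S. w u * real (d u)) < a}"
proof -
  have "finite S"
    using assms finite_subset by blast
  then show ?thesis
    using assms(2,5,7)
  proof (induction S arbitrary: a rule: finite_induct)
    case empty
    then show ?case
      using assms(6) by simp
  next
    case (insert i S)
    let ?M = "Pi_pmf A 0 (\<lambda>_. geometric_pmf q)"
    let ?W = "\<lambda>d. \<Sum>u\<in>S. w u * real (d u)"
    define s where "s = card S"
    define X where "X = {x::nat. real x * w i < a}"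
    have wi: "0 < w i" "exp (- c * w i) \<le> 1 - q"
      using insert.prems(3) by auto
    have finX: "finite X"
      unfolding X_def using wi by (intro finite_multiples_less)
    \<comment> \<open>Slicing by the value \<open>x\<close> of coordinate \<open>i\<close> leaves a
      simplex of one dimension less, with bound \<open>a - x * w i\<close>.\<close>
    define E where "E x = {d. d i = x \<and> ?W d < a - real x * w i}" for x
    have PE: "measure_pmf.prob ?M (E x) = (1 - q) ^ x * q * measure_pmf.prob ?M {d. ?W d < a - real x * w i}" for x
    proof -
      have "measure_pmf.prob ?M (E x) = measure_pmf.prob ?M {d. d i = x} * measure_pmf.prob ?M {d. ?W d < a - real x * w i}"
        unfolding E_def using insert.prems insert.hyps assms(1)
        by (intro prob_Pi_pmf_indep[where S="{i}" and T=S]) auto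
      then show ?thesis
        using insert.prems assms by (simp add: prob_geometric_component_eq)
    qed
    define K where "K = q ^ Suc s * exp (- c * a) / (fact s * (\<Prod>u\<in>S. w u))"
    have prodpos: "0 < (\<Prod>u\<in>S. w u)"
      using insert.prems by (intro prod_pos) auto
    have K: "0 \<le> K"
      unfolding K_def using assms prodpos by (auto intro!: divide_nonneg_nonneg mult_nonneg_nonneg)
    have lower: "K * (a - real x * w i) ^ s \<le> measure_pmf.prob ?M (E x)" if x: "x \<in> X" for x
    proof -
      have pos: "0 < a - real x * w i"
        using x by (simp add: X_def)
      have IH: "q ^ s * exp (- c * (a - real x * w i)) * (a - real x * w i) ^ s / (fact s * (\<Prod>u\<in>S. w u))
        \<le> measure_pmf.prob ?M {d. ?W d < a - real x * w i}"
        unfolding s_def using pos insert.prems by (intro insert.IH) auto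
      have "exp (- c * w i) ^ x \<le> (1 - q) ^ x"
        using wi by (intro power_mono) auto
      \<comment> \<open>The point mass \<open>(1 - q) ^ x\<close> makes up for replacing the
        exponent bound \<open>a - x * w i\<close> of the slice by \<open>a\<close>.\<close>
      then have ex: "exp (- c * a) \<le> (1 - q) ^ x * exp (- c * (a - real x * w i))"
      proof -
        have "exp (- c * a) = exp (- c * w i) ^ x * exp (- c * (a - real x * w i))"
          by (simp add: exp_of_nat_mult[symmetric] exp_add[symmetric] algebra_simps)
        also have "\<dots> \<le> (1 - q) ^ x * exp (- c * (a - real x * w i))"
          using \<open>exp (- c * w i) ^ x \<le> (1 - q) ^ x\<close> by (intro mult_right_mono) auto
        finally show ?thesis .
      qed
      have "K * (a - real x * w i) ^ s
          = exp (- c * a) * (q ^ Suc s * (a - real x * w i) ^ s / (fact s * (\<Prod>u\<in>S. w u)))"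
        by (simp add: K_def)
      also have "\<dots> \<le> ((1 - q) ^ x * exp (- c * (a - real x * w i))) * (q ^ Suc s * (a - real x * w i) ^ s / (fact s * (\<Prod>u\<in>S. w u)))"
        using ex assms prodpos pos by (intro mult_right_mono) (auto intro!: divide_nonneg_nonneg mult_nonneg_nonneg)
      also have "\<dots> = (1 - q) ^ x * q * (q ^ s * exp (- c * (a - real x * w i)) * (a - real x * w i) ^ s / (fact s * (\<Prod>u\<in>S. w u)))"
        by simp
      also have "\<dots> \<le> (1 - q) ^ x * q * measure_pmf.prob ?M {d. ?W d < a - real x * w i}"
        using IH assms by (intro mult_left_mono) auto
      finally show ?thesis
        by (simp add: PE)
    qed
    \<comment> \<open>Summing the slices is the Riemann sum that integrates the lower-dimensional
      volume.\<close>
    have "q ^ Suc s * exp (- c * a) * a ^ Suc s / (fact (Suc s) * (\<Prod>u\<in>insert i S. w u))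
        = K * (a ^ Suc s / (real (Suc s) * w i))"
      using insert.hyps by (simp add: K_def)
    also have "\<dots> \<le> K * (\<Sum>x\<in>X. (a - real x * w i) ^ s)"
      unfolding X_def using wi insert.prems K by (intro mult_left_mono riemann_sum_power_ge) auto
    also have "\<dots> = (\<Sum>x\<in>X. K * (a - real x * w i) ^ s)"
      by (simp add: sum_distrib_left)
    also have "\<dots> \<le> (\<Sum>x\<in>X. measure_pmf.prob ?M (E x))"
      by (intro sum_mono lower)
    also have "\<dots> = measure_pmf.prob ?M (\<Union>x\<in>X. E x)"
      using finX by (intro measure_pmf.finite_measure_finite_Union[symmetric]) (auto simp: disjoint_family_on_def E_def)
    also have "\<dots> \<le> measure_pmf.prob ?M {d. (\<Sum>u\<in>insert i S. w u * real (d u)) < a}"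
      using insert.hyps by (intro measure_pmf.finite_measure_mono) (auto simp: E_def mult.commute)
    finally show ?case
      using insert.hyps by (simp add: s_def)
  qed
qed

subsection \<open>Bounds on the solvability probability\<close>

lemma weight_altdef: "weight A d v = (\<Sum>u\<in>A. (1 / 2 ^ gap u v) * real (d u))"
  by (simp add: weight_def)

section \<open>Union bound over the vertices\<close>

text \<open>The moment bound is taken at \<open>t = m\<close>, the minimiser of
  \<open>exp t / t ^ m\<close>.\<close>

lemma prob_window_upper:
  assumes "0 < q" "q \<le> 1" "1 \<le> m" "W \<subseteq> {1..n}" "bij_betw (\<lambda>u. gap u v) W {0<..m}"
  shows "measure_pmf.prob (geometric_pebbles n q) {d. weight W d v < 1}
    \<le> exp (real m) * (\<Prod>k\<in>{0<..m}. q * (1 + 2 ^ k / real m))"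
proof -
  have "measure_pmf.prob (geometric_pebbles n q) {d. weight W d v < 1}
    \<le> exp (real m) * (\<Prod>u\<in>W. q * (1 + 1 / (real m * (1 / 2 ^ gap u v))))"
    unfolding weight_altdef using assms by (intro prob_weighted_sum_less_upper) auto
  also have "(\<Prod>u\<in>W. q * (1 + 1 / (real m * (1 / 2 ^ gap u v)))) = (\<Prod>k\<in>{0<..m}. q * (1 + 2 ^ k / real m))"
    using prod.reindex_bij_betw[OF assms(5), of "\<lambda>k. q * (1 + 2 ^ k / real m)"] by simp
  finally show ?thesis .
qed

text \<open>A vertex with \<open>m\<close> vertices on both sides is stuck with probability at most
  \<open>q * \<Phi>\<^sup>2\<close>, by independence of emptiness and the two windows. The
  \<open>2 * m\<close> vertices near the ends have only one full window and contribute
  \<open>q * \<Phi>\<close> each.\<close>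

lemma path_unsolvable_prob_upper:
  assumes "0 < q" "q \<le> 1" "1 \<le> m" "2 * m \<le> n"
  defines "\<Phi> \<equiv> exp (real m) * (\<Prod>k\<in>{0<..m}. q * (1 + 2 ^ k / real m))"
  shows "1 - path_solv_prob n q \<le> real n * (q * \<Phi>\<^sup>2) + 2 * real m * (q * \<Phi>)"
proof -
  let ?M = "geometric_pebbles n q"
  let ?P = "measure_pmf.prob ?M"
  have \<Phi>0: "0 \<le> \<Phi>"
    unfolding \<Phi>_def using assms by (intro mult_nonneg_nonneg prod_nonneg) auto
  define L where "L v = {v - m..<v}" for v
  define R where "R v = {v<..v + m}" for v
  have PL: "?P {d. weight (L v) d v < 1} \<le> \<Phi>" if "m < v" "v \<le> n" for v
    unfolding \<Phi>_def L_def using that assms bij_betw_gap_left[of v v "v - m"]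
    by (intro prob_window_upper) auto
  have PR: "?P {d. weight (R v) d v < 1} \<le> \<Phi>" if "v + m \<le> n" for v
    unfolding \<Phi>_def R_def using that assms bij_betw_gap_right[of v v "v + m"]
    by (intro prob_window_upper) auto
  have P0: "?P {d. d v = 0} = q" if "v \<in> {1..n}" for v
    using that assms by (subst prob_geometric_component_eq) auto
  have ind: "?P {d. d v = 0 \<and> weight W d v < 1} = q * ?P {d. weight W d v < 1}"
    if "v \<in> {1..n}" "W \<subseteq> {1..n}" "v \<notin> W" for v W
  proof -
    have "?P {d. d v = 0 \<and> weight W d v < 1} = ?P {d. d v = 0} * ?P {d. weight W d v < 1}"
      using that by (intro prob_Pi_pmf_indep[where S="{v}" and T=W]) (auto cong: weight_cong)
    then show ?thesis
      using P0[OF that(1)] by simp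
  qed
  have stuckL: "weight (L v) d v < 1" if "stuck n d v" "m < v" for d v
  proof -
    have "weight (L v) d v \<le> weight {1..<v} d v"
      using that(2) by (intro weight_subset) (auto simp: L_def)
    then show ?thesis
      using that(1) by (simp add: stuck_def)
  qed
  have stuckR: "weight (R v) d v < 1" if "stuck n d v" "v + m \<le> n" for d v
  proof -
    have "weight (R v) d v \<le> weight {v<..n} d v"
      using that(2) by (intro weight_subset) (auto simp: R_def)
    then show ?thesis
      using that(1) by (simp add: stuck_def)
  qed
  \<comment> \<open>If \<open>v \<le> m\<close>, then \<open>v + m \<le> 2 * m \<le> n\<close>, so
    at least one window always fits.\<close>
  have one: "?P {d. stuck n d v} \<le> q * \<Phi>" if "v \<in> {1..n}" for v
  proof (cases "m < v")
    case True
    have "?P {d. stuck n d v} \<le> ?P {d. d v = 0 \<and> weight (L v) d v < 1}"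
      using True by (intro measure_pmf.finite_measure_mono) (auto intro: stuckL simp: stuck_def[of n _ v])
    also have "\<dots> = q * ?P {d. weight (L v) d v < 1}"
      using that True by (intro ind) (auto simp: L_def)
    also have "\<dots> \<le> q * \<Phi>"
      using that True assms by (intro mult_left_mono PL) auto
    finally show ?thesis .
  next
    case False
    have "?P {d. stuck n d v} \<le> ?P {d. d v = 0 \<and> weight (R v) d v < 1}"
      using False assms by (intro measure_pmf.finite_measure_mono) (auto intro: stuckR simp: stuck_def[of n _ v])
    also have "\<dots> = q * ?P {d. weight (R v) d v < 1}"
      using that False assms by (intro ind) (auto simp: R_def)
    also have "\<dots> \<le> q * \<Phi>"
      using that False assms by (intro mult_left_mono PR) auto
    finally show ?thesis .
  qed
  have two: "?P {d. stuck n d v} \<le> q * \<Phi>\<^sup>2" if "m < v" "v + m \<le> n" for v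
  proof -
    have "?P {d. stuck n d v} \<le> ?P {d. (d v = 0 \<and> weight (L v) d v < 1) \<and> weight (R v) d v < 1}"
      using that by (intro measure_pmf.finite_measure_mono) (auto intro: stuckL stuckR simp: stuck_def[of n _ v])
    also have "\<dots> = ?P {d. d v = 0 \<and> weight (L v) d v < 1} * ?P {d. weight (R v) d v < 1}"
    proof (rule prob_Pi_pmf_indep[where S="insert v (L v)" and T="R v"])
      fix d e :: "nat \<Rightarrow> nat"
      show "(d v = 0 \<and> weight (L v) d v < 1) = (e v = 0 \<and> weight (L v) e v < 1)"
        if "\<And>u. u \<in> insert v (L v) \<Longrightarrow> d u = e u"
        using that weight_cong[of "L v" d e v] by auto
      show "(weight (R v) d v < 1) = (weight (R v) e v < 1)" if "\<And>u. u \<in> R v \<Longrightarrow> d u = e u"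
        using that weight_cong[of "R v" d e v] by auto
    qed (use that in \<open>auto simp: L_def R_def\<close>)
    also have "?P {d. d v = 0 \<and> weight (L v) d v < 1} = q * ?P {d. weight (L v) d v < 1}"
      using that by (intro ind) (auto simp: L_def)
    also have "\<dots> * ?P {d. weight (R v) d v < 1} \<le> (q * \<Phi>) * \<Phi>"
      using that assms \<Phi>0 by (intro mult_mono PL PR order.refl) auto
    finally show ?thesis
      by (simp add: power2_eq_square mult.assoc)
  qed
  define I where "I = {m<..n - m}"
  have I: "I \<subseteq> {1..n}" "card ({1..n} - I) = 2 * m"
  proof -
    show sub: "I \<subseteq> {1..n}"
      by (auto simp: I_def)
    show "card ({1..n} - I) = 2 * m"
      using assms(4) by (subst card_Diff_subset[OF _ sub]) (auto simp: I_def)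
  qed
  have "{d. \<not> path_solvable n d} = (\<Union>v\<in>{1..n}. {d. stuck n d v})"
    by (auto simp: path_solvable_iff)
  then have "?P {d. \<not> path_solvable n d} \<le> (\<Sum>v\<in>{1..n}. ?P {d. stuck n d v})"
    by (simp add: measure_pmf.finite_measure_subadditive_finite)
  also have "\<dots> = (\<Sum>v\<in>I. ?P {d. stuck n d v}) + (\<Sum>v\<in>{1..n} - I. ?P {d. stuck n d v})"
    using I by (subst sum.subset_diff[of I]) auto
  also have "\<dots> \<le> (\<Sum>v\<in>I. q * \<Phi>\<^sup>2) + (\<Sum>v\<in>{1..n} - I. q * \<Phi>)"
    by (intro add_mono sum_mono two one) (auto simp: I_def)
  also have "\<dots> = real (card I) * (q * \<Phi>\<^sup>2) + 2 * real m * (q * \<Phi>)"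
    using I by simp
  also have "\<dots> \<le> real n * (q * \<Phi>\<^sup>2) + 2 * real m * (q * \<Phi>)"
    using assms by (intro add_right_mono mult_right_mono) (auto simp: I_def)
  finally show ?thesis
    by (simp only: prob_not_path_solvable)
qed

section \<open>Locally stuck vertices and independent blocks\<close>

text \<open>The volume bound with \<open>c = 2 ^ m / l\<close>. The least weight in the window is
  \<open>1 / 2 ^ m\<close>, so each \<open>c * w u\<close> is at least \<open>1 / l\<close>, and
  \<open>exp (- (1 / l)) \<le> l / (1 + l) = 1 - q\<close>.\<close>

lemma prob_window_lower:
  assumes "0 < l" "W \<subseteq> {1..n}" "bij_betw (\<lambda>u. gap u v) W {0<..m}" "0 < a" "a \<le> 1"
  shows "inverse (1 + l) ^ m * exp (- (2 ^ m / l)) * a ^ m * (\<Prod>k\<in>{0<..m}. 2 ^ k) / fact m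
    \<le> measure_pmf.prob (geometric_pebbles n (inverse (1 + l))) {d. weight W d v < a}"
proof -
  let ?q = "inverse (1 + l)"
  have card: "card W = m"
    using bij_betw_same_card[OF assms(3)] by simp
  have prod: "(\<Prod>u\<in>W. 1 / 2 ^ gap u v :: real) = 1 / (\<Prod>k\<in>{0<..m}. 2 ^ k)"
    using prod.reindex_bij_betw[OF assms(3), of "\<lambda>k. 1 / 2 ^ k :: real"] by (simp add: prod_dividef)
  \<comment> \<open>Since \<open>a \<le> 1\<close>, the factor \<open>a\<close> may be dropped from
    the exponent.\<close>
  have "?q ^ m * exp (- (2 ^ m / l)) * a ^ m * (\<Prod>k\<in>{0<..m}. 2 ^ k) / fact m
      \<le> ?q ^ m * exp (- (2 ^ m / l) * a) * a ^ m * (\<Prod>k\<in>{0<..m}. 2 ^ k) / fact m"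
    using assms by (intro divide_right_mono mult_right_mono mult_left_mono prod_nonneg)
      (auto simp: mult_left_le divide_right_mono)
  also have "\<dots> = ?q ^ card W * exp (- (2 ^ m / l) * a) * a ^ card W / (fact (card W) * (\<Prod>u\<in>W. 1 / 2 ^ gap u v))"
    by (simp add: card prod)
  also have "\<dots> \<le> measure_pmf.prob (geometric_pebbles n ?q) {d. weight W d v < a}"
    unfolding weight_altdef
  proof (rule prob_weighted_sum_less_lower)
    fix u assume u: "u \<in> W"
    have "gap u v \<le> m"
      using u assms(3) by (auto simp: bij_betw_def)
    then have "(2::real) ^ gap u v \<le> 2 ^ m"
      by (intro power_increasing) auto
    then have "1 / l \<le> 2 ^ m / l * (1 / 2 ^ gap u v)"
      using assms(1) by (simp add: field_simps)
    then have "exp (- (2 ^ m / l) * (1 / 2 ^ gap u v)) \<le> exp (- (1 / l))"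
      by (subst exp_le_cancel_iff) simp
    also have "\<dots> \<le> 1 - ?q"
      using exp_ge_add_one_self[of "1 / l"] assms(1) by (simp add: exp_minus field_simps)
    finally show "0 < 1 / (2::real) ^ gap u v \<and> exp (- (2 ^ m / l) * (1 / 2 ^ gap u v)) \<le> 1 - ?q"
      by simp
  qed (use assms in \<open>auto simp: field_simps\<close>)
  finally show ?thesis .
qed

text \<open>Beyond distance \<open>m\<close> the mean weight is at most
  \<open>l / 2 ^ m \<le> \<delta> / 2\<close>, so Markov's inequality suffices.\<close>

lemma prob_outer_window:
  assumes "0 < l" "W \<subseteq> {1..n}" "bij_betw (\<lambda>u. gap u v) W {m<..M}" "m \<le> M" "0 < \<delta>" "2 * l \<le> \<delta> * 2 ^ m"
  shows "1 / 2 \<le> measure_pmf.prob (geometric_pebbles n (inverse (1 + l))) {d. weight W d v < \<delta>}"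
proof -
  let ?P = "measure_pmf.prob (geometric_pebbles n (inverse (1 + l)))"
  have "?P {d. \<delta> \<le> weight W d v} \<le> l * (\<Sum>u\<in>W. 1 / 2 ^ gap u v) / \<delta>"
    unfolding weight_altdef using assms by (intro prob_weighted_sum_ge) auto
  also have "\<dots> \<le> l * (1 / 2 ^ m) / \<delta>"
    using assms by (intro divide_right_mono mult_left_mono) (auto simp: sum_gap)
  also have "\<dots> \<le> 1 / 2"
    using assms by (simp add: field_simps)
  finally have "?P {d. \<delta> \<le> weight W d v} \<le> 1 / 2" .
  moreover have "?P (UNIV - {d. \<delta> \<le> weight W d v}) = 1 - ?P {d. \<delta> \<le> weight W d v}"
    using measure_pmf.prob_compl[of "{d. \<delta> \<le> weight W d v}" "geometric_pebbles n (inverse (1 + l))"] by simp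
  moreover have "UNIV - {d. \<delta> \<le> weight W d v} = {d. weight W d v < \<delta>}"
    by auto
  ultimately show ?thesis
    by simp
qed

text \<open>A version of being stuck that depends only on vertices within distance \<open>M\<close>.
  Each side has budget 1: \<open>1 - 2 * \<delta>\<close> up to distance \<open>m\<close>,
  \<open>\<delta>\<close> from there to \<open>M\<close>, and a reserve of \<open>\<delta>\<close>
  for everything beyond.\<close>

definition locally_stuck :: "nat \<Rightarrow> nat \<Rightarrow> real \<Rightarrow> nat \<Rightarrow> (nat \<Rightarrow> nat) \<Rightarrow> bool" where
  "locally_stuck m M \<delta> v d \<longleftrightarrow> d v = 0 \<and>
     (weight {v - m..<v} d v < 1 - 2 * \<delta> \<and> weight {v - M..<v - m} d v < \<delta>) \<and>
     (weight {v<..v + m} d v < 1 - 2 * \<delta> \<and> weight {v + m<..v + M} d v < \<delta>)"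

lemma locally_stuck_cong:
  assumes "\<And>u. u \<in> {v - M..v + M} \<Longrightarrow> d u = e u" "m \<le> M"
  shows "locally_stuck m M \<delta> v d = locally_stuck m M \<delta> v e"
proof -
  have w: "weight W d v = weight W e v" if "W \<subseteq> {v - M..v + M}" for W
    using that assms by (intro weight_cong) auto
  have "weight {v - m..<v} d v = weight {v - m..<v} e v" "weight {v - M..<v - m} d v = weight {v - M..<v - m} e v"
    "weight {v<..v + m} d v = weight {v<..v + m} e v" "weight {v + m<..v + M} d v = weight {v + m<..v + M} e v"
    using assms(2) by (auto intro!: w)
  moreover have "d v = e v"
    using assms by simp
  ultimately show ?thesis
    by (simp add: locally_stuck_def)
qed

text \<open>If no pile exceeds \<open>D\<close>, the vertices beyond distance \<open>M\<close> weigh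
  at most \<open>D / 2 ^ M \<le> \<delta>\<close>, which fits into the reserve.\<close>

lemma stuck_if_locally_stuck:
  assumes "locally_stuck m M \<delta> v d" "m \<le> M" "M < v" "v + M \<le> n"
    and D: "\<And>u. u \<in> {1..n} \<Longrightarrow> real (d u) \<le> D" "0 \<le> D" "D \<le> \<delta> * 2 ^ M"
  shows "stuck n d v"
proof -
  have far: "weight W d v \<le> \<delta>" if W: "W \<subseteq> {1..n}" "bij_betw (\<lambda>u. gap u v) W {M<..b}" "M \<le> b" for W b
  proof -
    have "weight W d v \<le> (\<Sum>u\<in>W. D * (1 / 2 ^ gap u v))"
      unfolding weight_def using W D by (intro sum_mono) (auto simp: divide_right_mono)
    also have "\<dots> = D * (1 / 2 ^ M - 1 / 2 ^ b)"
      unfolding sum_distrib_left[symmetric] by (subst sum_gap[OF W(2,3)]) simp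
    also have "\<dots> \<le> D * (1 / 2 ^ M)"
      using D by (intro mult_left_mono) auto
    also have "\<dots> \<le> \<delta>"
      using D by (simp add: field_simps)
    finally show ?thesis .
  qed
  have "weight {1..<v - M} d v \<le> \<delta>"
    using assms bij_betw_gap_left[of "v - M" v 1] by (intro far[where b="v - 1"]) auto
  moreover have split: "{1..<v} = ({1..<v - M} \<union> {v - M..<v - m}) \<union> {v - m..<v}"
    using assms by auto
  have "weight {1..<v} d v = weight {1..<v - M} d v + weight {v - M..<v - m} d v + weight {v - m..<v} d v"
    unfolding split by (rule weight_union3) (use assms in auto)
  moreover have "weight {v + M<..n} d v \<le> \<delta>"
    using assms bij_betw_gap_right[of v "v + M" n] by (intro far[where b="n - v"]) auto
  moreover have split: "{v<..n} = ({v + M<..n} \<union> {v + m<..v + M}) \<union> {v<..v + m}"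
    using assms by auto
  have "weight {v<..n} d v = weight {v + M<..n} d v + weight {v + m<..v + M} d v + weight {v<..v + m} d v"
    unfolding split by (rule weight_union3) (use assms in auto)
  ultimately show ?thesis
    using assms(1) by (auto simp: stuck_def locally_stuck_def)
qed

text \<open>Independent factors: \<open>q\<close> for the empty vertex, and on each side
  \<open>g\<close> for the near window and \<open>1 / 2\<close> for the outer one.\<close>

lemma prob_locally_stuck:
  assumes "0 < l" "0 < \<delta>" "2 * \<delta> < 1" "2 * l \<le> \<delta> * 2 ^ m" "m \<le> M" "M < v" "v + M \<le> n"
  defines "q \<equiv> inverse (1 + l)"
  defines "g \<equiv> q ^ m * exp (- (2 ^ m / l)) * (1 - 2 * \<delta>) ^ m * (\<Prod>k\<in>{0<..m}. 2 ^ k) / fact m"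
  shows "q * g\<^sup>2 / 4 \<le> measure_pmf.prob (geometric_pebbles n q) {d. locally_stuck m M \<delta> v d}"
proof -
  let ?P = "measure_pmf.prob (geometric_pebbles n q)"
  have q: "0 < q" "q \<le> 1"
    using assms(1) by (auto simp: q_def field_simps)
  have g0: "0 \<le> g"
    unfolding g_def using q assms by (intro divide_nonneg_nonneg mult_nonneg_nonneg prod_nonneg) auto
  have side: "g * (1 / 2) \<le> ?P {d. weight W d v < 1 - 2 * \<delta> \<and> weight W' d v < \<delta>}"
    if "W \<subseteq> {1..n}" "W' \<subseteq> {1..n}" "W \<inter> W' = {}"
      "bij_betw (\<lambda>u. gap u v) W {0<..m}" "bij_betw (\<lambda>u. gap u v) W' {m<..M}" for W W'
  proof -
    have "g \<le> ?P {d. weight W d v < 1 - 2 * \<delta>}"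
      unfolding g_def q_def using that assms(1-7) by (intro prob_window_lower) auto
    moreover have "1 / 2 \<le> ?P {d. weight W' d v < \<delta>}"
      unfolding q_def using that assms(1-7) by (intro prob_outer_window) auto
    ultimately have "g * (1 / 2) \<le> ?P {d. weight W d v < 1 - 2 * \<delta>} * ?P {d. weight W' d v < \<delta>}"
      by (intro mult_mono) auto
    also have "\<dots> = ?P {d. weight W d v < 1 - 2 * \<delta> \<and> weight W' d v < \<delta>}"
      using that by (intro prob_Pi_pmf_indep[symmetric, where S=W and T=W']) (auto cong: weight_cong)
    finally show ?thesis .
  qed
  define EL where "EL d \<longleftrightarrow> weight {v - m..<v} d v < 1 - 2 * \<delta> \<and> weight {v - M..<v - m} d v < \<delta>" for d
  define ER where "ER d \<longleftrightarrow> weight {v<..v + m} d v < 1 - 2 * \<delta> \<and> weight {v + m<..v + M} d v < \<delta>" for d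
  have L: "g * (1 / 2) \<le> ?P {d. EL d}"
    unfolding EL_def using assms bij_betw_gap_left[of v v "v - m"] bij_betw_gap_left[of "v - m" v "v - M"]
    by (intro side) auto
  have R: "g * (1 / 2) \<le> ?P {d. ER d}"
    unfolding ER_def using assms bij_betw_gap_right[of v v "v + m"] bij_betw_gap_right[of v "v + m" "v + M"]
    by (intro side) auto
  have depL: "EL d = EL e" if "\<And>u. u \<in> {v - M..<v} \<Longrightarrow> d u = e u" for d e
  proof -
    have "weight {v - m..<v} d v = weight {v - m..<v} e v" "weight {v - M..<v - m} d v = weight {v - M..<v - m} e v"
      using assms(5) by (auto intro!: weight_cong that)
    then show ?thesis
      by (simp add: EL_def)
  qed
  have depR: "ER d = ER e" if "\<And>u. u \<in> {v<..v + M} \<Longrightarrow> d u = e u" for d e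
  proof -
    have "weight {v<..v + m} d v = weight {v<..v + m} e v" "weight {v + m<..v + M} d v = weight {v + m<..v + M} e v"
      using assms(5) by (auto intro!: weight_cong that)
    then show ?thesis
      by (simp add: ER_def)
  qed
  have "q * g\<^sup>2 / 4 = q * ((g * (1 / 2)) * (g * (1 / 2)))"
    by (simp add: power2_eq_square)
  also have "\<dots> \<le> q * (?P {d. EL d} * ?P {d. ER d})"
    using q g0 by (intro mult_left_mono mult_mono L R) auto
  also have "?P {d. EL d} * ?P {d. ER d} = ?P {d. EL d \<and> ER d}"
    using assms by (intro prob_Pi_pmf_indep[symmetric, where S="{v - M..<v}" and T="{v<..v + M}"] depL depR) auto
  also have "q * ?P {d. EL d \<and> ER d} = ?P {d. d v = 0} * ?P {d. EL d \<and> ER d}"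
    using q assms by (subst prob_geometric_component_eq) auto
  also have "\<dots> = ?P {d. d v = 0 \<and> (EL d \<and> ER d)}"
  proof (rule prob_Pi_pmf_indep[symmetric, where S="{v}" and T="{v - M..<v} \<union> {v<..v + M}"])
    fix d e :: "nat \<Rightarrow> nat"
    assume "\<And>u. u \<in> {v - M..<v} \<union> {v<..v + M} \<Longrightarrow> d u = e u"
    then show "(EL d \<and> ER d) = (EL e \<and> ER e)"
      using depL[of d e] depR[of d e] by auto
  qed (use assms in auto)
  also have "\<dots> = ?P {d. locally_stuck m M \<delta> v d}"
    by (simp add: locally_stuck_def EL_def ER_def)
  finally show ?thesis .
qed

text \<open>The centres of \<open>N\<close> disjoint blocks all fail to be locally stuck with
  probability at most \<open>(1 - p) ^ N \<le> exp (- p * N)\<close>, where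
  \<open>p = q * g\<^sup>2 / 4\<close>. The second term bounds the event that some pile reaches
  \<open>D\<close>, by Markov's inequality at every vertex.\<close>

lemma path_solv_prob_upper:
  assumes "0 < l" "0 < \<delta>" "2 * \<delta> < 1" "2 * l \<le> \<delta> * 2 ^ m" "m \<le> M" "N * (2 * M + 1) \<le> n"
    and D: "0 < D" "D \<le> \<delta> * 2 ^ M"
  defines "q \<equiv> inverse (1 + l)"
  defines "g \<equiv> q ^ m * exp (- (2 ^ m / l)) * (1 - 2 * \<delta>) ^ m * (\<Prod>k\<in>{0<..m}. 2 ^ k) / fact m"
  shows "path_solv_prob n q \<le> exp (- (q * g\<^sup>2 / 4) * real N) + real n * (l / D)"
proof -
  let ?P = "measure_pmf.prob (geometric_pebbles n q)"
  \<comment> \<open>The middle of the \<open>i\<close>-th block of \<open>2 * M + 1\<close>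
    consecutive vertices, counting blocks from 0 and vertices from 1.\<close>
  define c where "c i = i * (2 * M + 1) + M + 1" for i
  have c: "M < c i" "c i + M \<le> n" if "i < N" for i
  proof -
    have "Suc i * (2 * M + 1) \<le> N * (2 * M + 1)"
      using that by (intro mult_right_mono) auto
    then show "M < c i" "c i + M \<le> n"
      using assms(6) by (auto simp: c_def)
  qed
  have disj: "disjoint_family_on (\<lambda>i. {c i - M..c i + M}) {..<N}"
  proof -
    have "c i + M < c j - M" if "i < j" for i j
    proof -
      have "Suc i * (2 * M + 1) \<le> j * (2 * M + 1)"
        using that by (intro mult_right_mono) auto
      then show ?thesis
        by (simp add: c_def)
    qed
    then show ?thesis
      unfolding disjoint_family_on_def by (metis (no_types, opaque_lifting) Int_emptyI atLeastAtMost_iff leD le_less_trans less_le_trans linorder_neqE_nat)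
  qed
  have "?P {d. \<forall>i\<in>{..<N}. \<not> locally_stuck m M \<delta> (c i) d}
      = (\<Prod>i<N. ?P {d. \<not> locally_stuck m M \<delta> (c i) d})"
  proof (rule prob_Pi_pmf_indep_family[OF _ _ _ disj])
    show "(\<not> locally_stuck m M \<delta> (c i) d) = (\<not> locally_stuck m M \<delta> (c i) e)"
      if "\<And>u. u \<in> {c i - M..c i + M} \<Longrightarrow> d u = e u" for i d e
      using locally_stuck_cong[OF that assms(5)] by simp
    show "{c i - M..c i + M} \<subseteq> {1..n}" if "i \<in> {..<N}" for i
      using c[of i] that by auto
  qed auto
  also have "\<dots> \<le> (\<Prod>i<N. exp (- (q * g\<^sup>2 / 4)))"
  proof (intro prod_mono conjI)
    fix i assume i: "i \<in> {..<N}"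
    have "q * g\<^sup>2 / 4 \<le> ?P {d. locally_stuck m M \<delta> (c i) d}"
      unfolding q_def g_def using assms c[of i] i by (intro prob_locally_stuck) auto
    moreover have "?P (UNIV - {d. locally_stuck m M \<delta> (c i) d}) = 1 - ?P {d. locally_stuck m M \<delta> (c i) d}"
      using measure_pmf.prob_compl[of "{d. locally_stuck m M \<delta> (c i) d}" "geometric_pebbles n q"] by simp
    moreover have "UNIV - {d. locally_stuck m M \<delta> (c i) d} = {d. \<not> locally_stuck m M \<delta> (c i) d}"
      by auto
    ultimately show "?P {d. \<not> locally_stuck m M \<delta> (c i) d} \<le> exp (- (q * g\<^sup>2 / 4))"
      using exp_ge_add_one_self[of "- (q * g\<^sup>2 / 4)"] by simp
  qed simp
  finally have blocks: "?P {d. \<forall>i\<in>{..<N}. \<not> locally_stuck m M \<delta> (c i) d} \<le> exp (- (q * g\<^sup>2 / 4) * real N)"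
    by (simp add: exp_of_nat_mult[symmetric] mult.commute)
  have "?P (\<Union>u\<in>{1..n}. {d. D \<le> real (d u)}) \<le> (\<Sum>u\<in>{1..n}. ?P {d. D \<le> real (d u)})"
    by (intro measure_pmf.finite_measure_subadditive_finite) auto
  also have "\<dots> \<le> (\<Sum>u\<in>{1..n}. l / D)"
  proof (rule sum_mono)
    fix u assume "u \<in> {1..n}"
    then show "?P {d. D \<le> real (d u)} \<le> l / D"
      unfolding q_def using assms prob_weighted_sum_ge[of "{1..n}" "{u}" l D "\<lambda>_. 1"] by simp
  qed
  finally have large: "?P (\<Union>u\<in>{1..n}. {d. D \<le> real (d u)}) \<le> real n * (l / D)"
    by simp
  have "path_solv_prob n q \<le> ?P ({d. \<forall>i\<in>{..<N}. \<not> locally_stuck m M \<delta> (c i) d} \<union> (\<Union>u\<in>{1..n}. {d. D \<le> real (d u)}))"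
    unfolding path_solv_prob_def
  proof (intro measure_pmf.finite_measure_mono subsetI)
    fix d assume d: "d \<in> {d. path_solvable n d}"
    show "d \<in> {d. \<forall>i\<in>{..<N}. \<not> locally_stuck m M \<delta> (c i) d} \<union> (\<Union>u\<in>{1..n}. {d. D \<le> real (d u)})"
    proof (rule ccontr)
      assume not: "\<not> ?thesis"
      then obtain i where i: "i < N" "locally_stuck m M \<delta> (c i) d"
        by auto
      have "stuck n d (c i)"
        by (rule stuck_if_locally_stuck[OF i(2), where D=D]) (use not assms c[of i] i in \<open>auto simp: not_le less_imp_le\<close>)
      moreover have "c i \<in> {1..n}"
        using c[OF i(1)] by auto
      ultimately show False
        using d by (auto simp: path_solvable_iff)
    qed
  qed simp
  also have "\<dots> \<le> ?P {d. \<forall>i\<in>{..<N}. \<not> locally_stuck m M \<delta> (c i) d} + ?P (\<Union>u\<in>{1..n}. {d. D \<le> real (d u)})"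
    by (rule measure_Un_le) auto
  finally show ?thesis
    using blocks large by simp
qed

subsection \<open>Asymptotics of the threshold\<close>

text \<open>A weak Stirling bound; the induction step amounts to
  \<open>1 \<le> (m + 1) * ln ((m + 1) / m)\<close>.\<close>

lemma ln_fact_le:
  assumes "1 \<le> m"
  shows "ln (fact m :: real) \<le> real m * ln (real m) - real m + 1 + ln (real m)"
  using assms
proof (induction m rule: nat_induct_at_least)
  case (Suc m)
  let ?x = "real m"
  have "1 / (?x + 1) \<le> ln ((?x + 1) / ?x)"
    using ln_one_minus_pos_upper_bound[of "1 / (?x + 1)"] Suc.hyps
    by (simp add: field_simps ln_div)
  then have "1 \<le> (?x + 1) * (ln (?x + 1) - ln ?x)"
    using Suc.hyps by (simp add: ln_div field_simps)
  moreover have "ln (fact (Suc m) :: real) = ln (?x + 1) + ln (fact m)"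
    by (simp add: ln_mult add.commute)
  ultimately show ?case
    using Suc.IH by (simp add: algebra_simps)
qed simp

text \<open>Squaring avoids halving the exponent \<open>m * (m + 1)\<close>; only the square of this
  product enters the final estimates.\<close>

lemma prod_two_powers: "(\<Prod>k\<in>{0<..m}. (2::real) ^ k)\<^sup>2 = 2 ^ (m * (m + 1))"
proof (induction m)
  case (Suc m)
  have "{0<..Suc m} = insert (Suc m) {0<..m}"
    by auto
  then have "(\<Prod>k\<in>{0<..Suc m}. (2::real) ^ k)\<^sup>2 = (2 ^ Suc m)\<^sup>2 * (\<Prod>k\<in>{0<..m}. 2 ^ k)\<^sup>2"
    by (simp add: power_mult_distrib del: power_Suc)
  also have "\<dots> = 2 ^ (2 * Suc m + m * (m + 1))"
    by (simp only: Suc.IH power_mult[symmetric] power_add mult.commute)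
  also have "2 * Suc m + m * (m + 1) = Suc m * (Suc m + 1)"
    by simp
  finally show ?case .
qed simp

lemma ln_prod_two_powers: "2 * ln (\<Prod>k\<in>{0<..m}. (2::real) ^ k) = real m * (real m + 1) * ln 2"
proof -
  have pos: "0 < (\<Prod>k\<in>{0<..m}. (2::real) ^ k)"
    by (intro prod_pos) auto
  have "2 * ln (\<Prod>k\<in>{0<..m}. (2::real) ^ k) = ln ((\<Prod>k\<in>{0<..m}. (2::real) ^ k)\<^sup>2)"
    using pos by (simp add: ln_realpow)
  then show ?thesis
    unfolding prod_two_powers by (simp add: ln_realpow algebra_simps)
qed

text \<open>Equivalent to \<open>1 + y\<^sup>2 \<le> exp y\<close> for \<open>y \<ge> 0\<close>,
  which follows from \<open>2 * y \<le> exp y\<close>. With this bound the correction terms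
  \<open>ln (1 + m / 2 ^ k)\<close> are dominated by a geometric series.\<close>

lemma ln_one_plus_le_sqrt:
  assumes "0 \<le> (x::real)"
  shows "ln (1 + x) \<le> sqrt x"
proof -
  have "1 + x \<le> exp (sqrt x)"
  proof -
    have "1 + y\<^sup>2 \<le> exp y" if "0 \<le> y" for y :: real
    proof -
      let ?f = "\<lambda>y::real. exp y - 1 - y\<^sup>2"
      have "?f 0 \<le> ?f y"
      proof (rule DERIV_nonneg_imp_nondecreasing[OF that])
        fix z :: real assume z: "0 \<le> z"
        have "2 * z \<le> exp z"
        proof -
          have "z \<le> exp (z - 1)"
            using exp_ge_add_one_self[of "z - 1"] by simp
          then have "exp 1 * z \<le> exp z"
            by (simp add: exp_diff field_simps)
          moreover have "2 \<le> exp (1::real)"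
            using exp_ge_add_one_self[of 1] by simp
          ultimately show ?thesis
            using z mult_right_mono[of 2 "exp 1" z] by linarith
        qed
        moreover have "DERIV ?f z :> exp z - 2 * z"
          by (auto intro!: derivative_eq_intros)
        ultimately show "\<exists>w. DERIV ?f z :> w \<and> 0 \<le> w"
          by force
      qed
      then show ?thesis
        by simp
    qed
    from this[of "sqrt x"] show ?thesis
      using assms by simp
  qed
  then have "ln (1 + x) \<le> ln (exp (sqrt x))"
    using assms by (subst ln_le_cancel_iff) auto
  then show ?thesis
    by simp
qed

text \<open>The ratio \<open>sqrt (1 / 2)\<close> is rounded up to \<open>3 / 4\<close>, whose
  powers from exponent 1 on sum to at most 3.\<close>

lemma sum_sqrt_powers_le: "(\<Sum>k\<in>{0<..m}. sqrt (real j / 2 ^ k)) \<le> 3 * sqrt (real j)"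
proof -
  have "sqrt (1 / 2) \<le> (3 / 4 :: real)"
    by (rule real_le_lsqrt) (auto simp: power2_eq_square)
  then have "sqrt (real j / 2 ^ k) \<le> sqrt (real j) * (3 / 4) ^ k" for k
  proof -
    have "sqrt (real j / 2 ^ k) = sqrt (real j) * sqrt (1 / 2) ^ k"
      by (simp add: real_sqrt_divide real_sqrt_power power_divide)
    also have "\<dots> \<le> sqrt (real j) * (3 / 4) ^ k"
      using \<open>sqrt (1 / 2) \<le> (3 / 4 :: real)\<close> by (intro mult_left_mono power_mono) auto
    finally show ?thesis .
  qed
  then have "(\<Sum>k\<in>{0<..m}. sqrt (real j / 2 ^ k)) \<le> (\<Sum>k\<in>{0<..m}. sqrt (real j) * (3 / 4) ^ k)"
    by (intro sum_mono)
  also have "\<dots> = sqrt (real j) * (\<Sum>k\<in>{0<..m}. (3 / 4) ^ k)"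
    by (simp add: sum_distrib_left)
  also have "(\<Sum>k\<in>{0<..m}. (3 / 4) ^ k) = 3 - 3 * (3 / 4 :: real) ^ m"
  proof (induction m)
    case (Suc m)
    have "{0<..Suc m} = insert (Suc m) {0<..m}"
      by auto
    then show ?case
      using Suc by simp
  qed simp
  also have "sqrt (real j) * \<dots> \<le> sqrt (real j) * 3"
    by (intro mult_left_mono) auto
  finally show ?thesis
    by (simp add: mult.commute)
qed

text \<open>Up to the factors \<open>1 + m / 2 ^ k\<close>, the value of \<open>\<Phi>\<close> is
  \<open>(exp 1 * q / m) ^ m * 2 ^ (m * (m + 1) / 2)\<close>. Those factors cost at most
  \<open>3 * sqrt m\<close> in the logarithm, an error of the permitted order.\<close>

lemma chernoff_factor_le:
  assumes "0 < q" "1 \<le> m"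
  defines "\<Phi> \<equiv> exp (real m) * (\<Prod>k\<in>{0<..m}. q * (1 + 2 ^ k / real m))"
  shows "0 < \<Phi>"
    and "2 * ln \<Phi> \<le> 2 * real m + 2 * real m * ln q + real m * (real m + 1) * ln 2
      - 2 * real m * ln (real m) + 6 * sqrt (real m)"
proof -
  have pos: "0 < q * (1 + 2 ^ k / real m)" for k
    using assms by (intro mult_pos_pos add_pos_nonneg) auto
  then show "0 < \<Phi>"
    unfolding \<Phi>_def by (intro mult_pos_pos[OF exp_gt_zero] prod_pos pos)
  have ln_factor: "ln (q * (1 + 2 ^ k / real m)) = ln q + ln (2 ^ k) - ln (real m) + ln (1 + real m / 2 ^ k)" for k
  proof -
    have "q * (1 + 2 ^ k / real m) = q * 2 ^ k / real m * (1 + real m / 2 ^ k)"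
      using assms(1,2) by (simp add: field_simps)
    moreover have "0 < 1 + real m / 2 ^ k"
      by (intro add_pos_nonneg) auto
    ultimately show ?thesis
      using assms(1,2) by (simp add: ln_mult ln_div)
  qed
  have "ln \<Phi> = real m + ln (\<Prod>k\<in>{0<..m}. q * (1 + 2 ^ k / real m))"
  proof -
    have *: "ln (exp (real m) * P) = real m + ln P" if "0 < P" for P :: real
      using that by (simp add: ln_mult)
    show ?thesis
      unfolding \<Phi>_def by (rule *) (intro prod_pos pos)
  qed
  also have "ln (\<Prod>k\<in>{0<..m}. q * (1 + 2 ^ k / real m)) = (\<Sum>k\<in>{0<..m}. ln (q * (1 + 2 ^ k / real m)))"
    by (rule ln_prod) (simp, metis pos less_irrefl)
  also have "real m + (\<Sum>k\<in>{0<..m}. ln (q * (1 + 2 ^ k / real m)))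
      = real m + real m * ln q + ln (\<Prod>k\<in>{0<..m}. (2::real) ^ k) - real m * ln (real m)
      + (\<Sum>k\<in>{0<..m}. ln (1 + real m / 2 ^ k))"
  proof -
    have "ln (\<Prod>k\<in>{0<..m}. (2::real) ^ k) = (\<Sum>k\<in>{0<..m}. ln (2 ^ k))"
      by (rule ln_prod) auto
    then show ?thesis
      unfolding ln_factor sum.distrib sum_subtractf by simp
  qed
  also have "(\<Sum>k\<in>{0<..m}. ln (1 + real m / 2 ^ k)) \<le> (\<Sum>k\<in>{0<..m}. sqrt (real m / 2 ^ k))"
    by (intro sum_mono ln_one_plus_le_sqrt) auto
  also have "\<dots> \<le> 3 * sqrt (real m)"
    by (rule sum_sqrt_powers_le)
  finally show "2 * ln \<Phi> \<le> 2 * real m + 2 * real m * ln q + real m * (real m + 1) * ln 2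
      - 2 * real m * ln (real m) + 6 * sqrt (real m)"
    using ln_prod_two_powers[of m] by simp
qed

lemma ln_le_two_sqrt:
  assumes "0 < (s::real)"
  shows "ln s \<le> 2 * sqrt s"
proof -
  have "ln s = 2 * ln (sqrt s)"
    using assms by (simp add: ln_sqrt)
  also have "ln (sqrt s) \<le> sqrt s - 1"
    using assms by (intro ln_le_minus_one) auto
  finally show ?thesis
    by simp
qed

section \<open>The solvability probability near the predicted threshold\<close>

text \<open>The predicted threshold per vertex, to be used with
  \<open>s = sqrt (log 2 n)\<close>.\<close>

definition path_density :: "real \<Rightarrow> real" where
  "path_density s = exp 1 * 2 powr s / s"

lemma ln_path_density:
  assumes "0 < s" "0 < c"
  shows "ln (path_density s * c) = 1 + s * ln 2 - ln s + ln c"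
  unfolding path_density_def using assms by (simp add: ln_mult ln_div ln_powr)

text \<open>With \<open>m\<close> equal to \<open>s\<close> rounded up, the leading terms of
  \<open>ln (n * q * \<Phi>\<^sup>2)\<close> cancel up to \<open>O (sqrt s)\<close>. The factor
  \<open>1 + 200 / sqrt s\<close> in the density enters about \<open>2 * s\<close> times and pushes
  the logarithm far below 0.\<close>

lemma path_solv_prob_above:
  fixes s :: real and n :: nat
  assumes "160000 \<le> s" "real n = 2 powr (s\<^sup>2)" "4 * (s + 2)\<^sup>2 \<le> real n"
  shows "1 / 2 < path_solv_prob n (inverse (1 + path_density s * (1 + 200 / sqrt s)))"
proof -
  define l where "l = path_density s * (1 + 200 / sqrt s)"
  define q where "q = inverse (1 + l)"
  define m where "m = nat \<lceil>s\<rceil>"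
  define x where "x = real m"
  define r where "r = sqrt s"
  have r: "400 \<le> r" "r * r = s" "0 < r"
    using assms(1) real_le_rsqrt[of 400 s] by (auto simp: r_def power2_eq_square)
  have m: "s \<le> x" "x \<le> s + 1" "1 \<le> m"
    using assms(1) by (auto simp: m_def x_def) linarith+
  have l: "0 < l"
    using assms(1) r by (auto simp: l_def path_density_def r_def intro!: mult_pos_pos divide_pos_pos add_pos_nonneg)
  have q: "0 < q" "q \<le> 1"
    using l by (auto simp: q_def field_simps)
  have "4 * (s + 2)\<^sup>2 \<ge> 4 * (x + 1)\<^sup>2"
    using m assms(1) by (intro mult_left_mono power_mono) auto
  then have n: "4 * (x + 1)\<^sup>2 \<le> real n"
    using assms(3) by linarith
  have "2 * m \<le> n"
  proof -
    have "2 * x \<le> 4 * (x + 1)\<^sup>2"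
      using m assms(1) by (simp add: power2_eq_square algebra_simps)
    then have "real (2 * m) \<le> real n"
      using n by (simp add: x_def)
    then show ?thesis
      by (simp only: of_nat_le_iff)
  qed
  have n0: "0 < real n"
    using assms(2) by simp
  define \<Phi> where "\<Phi> = exp (real m) * (\<Prod>k\<in>{0<..m}. q * (1 + 2 ^ k / real m))"
  have \<Phi>: "0 < \<Phi>" "2 * ln \<Phi> \<le> 2 * x + 2 * x * ln q + x * (x + 1) * ln 2 - 2 * x * ln x + 6 * sqrt x"
    using chernoff_factor_le[OF q(1) m(3)] by (auto simp: \<Phi>_def x_def)
  have "ln q \<le> - ln l"
    using l by (simp add: q_def ln_inverse)
  also have "ln l = 1 + s * ln 2 - ln s + ln (1 + 200 / r)"
    unfolding l_def r_def using assms(1) by (intro ln_path_density) (auto intro!: add_pos_nonneg)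
  finally have lnq: "ln q \<le> - (1 + s * ln 2 - ln s + 100 / r)"
  proof -
    assume *: "ln q \<le> - (1 + s * ln 2 - ln s + ln (1 + 200 / r))"
    define e where "e = 200 / r"
    have e: "0 \<le> e" "e \<le> 1 / 2"
      using r by (auto simp: e_def)
    \<comment> \<open>Since \<open>e \<le> 1 / 2\<close>, at least half of
      \<open>e = 200 / r\<close> survives in the logarithm.\<close>
    have "e / 2 \<le> e - e\<^sup>2"
      using e mult_left_mono[of e "1 / 2" e] by (simp add: power2_eq_square)
    also have "\<dots> \<le> ln (1 + e)"
      using e by (intro ln_one_plus_pos_lower_bound) auto
    finally show ?thesis
      using * by (simp add: e_def)
  qed
  \<comment> \<open>The logarithm of the main term \<open>n * q * \<Phi>\<^sup>2\<close> of the
    union bound.\<close>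
  define E where "E = ln (real n) + ln q + 2 * ln \<Phi>"
  have "E \<le> s\<^sup>2 * ln 2 + (2 * x + 1) * ln q + 2 * x + x * (x + 1) * ln 2 - 2 * x * ln x + 6 * sqrt x"
    using \<Phi>(2) by (simp add: E_def assms(2) ln_powr algebra_simps)
  also have "\<dots> \<le> s\<^sup>2 * ln 2 - (2 * x + 1) * (1 + s * ln 2 - ln s + 100 / r) + 2 * x
      + x * (x + 1) * ln 2 - 2 * x * ln x + 6 * sqrt x"
  proof -
    have "(2 * x + 1) * ln q \<le> (2 * x + 1) * - (1 + s * ln 2 - ln s + 100 / r)"
      using m assms(1) by (intro mult_left_mono lnq) auto
    then show ?thesis
      unfolding mult_minus_right by linarith
  qed
  \<comment> \<open>The quadratic terms \<open>s\<^sup>2\<close>, \<open>- 2 * x * s\<close> and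
    \<open>x\<^sup>2\<close> combine into a square, which is bounded because
    \<open>s \<le> x \<le> s + 1\<close>.\<close>
  also have "\<dots> = ln 2 * ((x - s)\<^sup>2 + (x - s)) - 1 + 2 * x * (ln s - ln x) + ln s - (2 * x + 1) * (100 / r) + 6 * sqrt x"
    by (simp add: algebra_simps power2_eq_square)
  \<comment> \<open>The gain is \<open>2 * s * (100 / r) = 200 * r\<close>; the losses
    \<open>2 * r\<close> and \<open>12 * r\<close> come from \<open>ln s\<close> and
    \<open>6 * sqrt x\<close>.\<close>
  also have "\<dots> \<le> 2 - 1 + 0 + 2 * r - 200 * r + 12 * r"
  proof (intro add_mono diff_mono)
    have "(x - s)\<^sup>2 \<le> 1\<^sup>2"
      using m by (intro power_mono) auto
    then have "ln 2 * ((x - s)\<^sup>2 + (x - s)) \<le> 1 * 2"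
      using m ln_2_less_1 by (intro mult_mono) auto
    then show "ln 2 * ((x - s)\<^sup>2 + (x - s)) \<le> 2"
      by simp
    show "2 * x * (ln s - ln x) \<le> 0"
      using m assms(1) by (intro mult_nonneg_nonpos) auto
    show "ln s \<le> 2 * r"
      unfolding r_def using assms(1) by (intro ln_le_two_sqrt) auto
    have "2 * (r * r) * (100 / r) \<le> (2 * x + 1) * (100 / r)"
      using r m by (intro mult_right_mono) auto
    moreover have "2 * (r * r) * (100 / r) = 200 * r"
      using r(3) by simp
    ultimately show "200 * r \<le> (2 * x + 1) * (100 / r)"
      by simp
    have "sqrt x \<le> sqrt (4 * s)"
      using m assms(1) by (intro real_sqrt_le_mono) auto
    then show "6 * sqrt x \<le> 12 * r"
      by (simp add: r_def real_sqrt_mult)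
  qed auto
  also have "\<dots> \<le> - 8"
    using r by simp
  finally have E: "E \<le> - 8" .
  have expE: "real n * (q * \<Phi>\<^sup>2) = exp E"
    unfolding E_def using \<Phi> q n0 by (simp add: exp_add exp_double power2_eq_square)
  \<comment> \<open>The end vertices need no estimate of their own: as
    \<open>4 * x\<^sup>2 \<le> n\<close>, the square of their term is at most the main term.\<close>
  have "(2 * x * (q * \<Phi>))\<^sup>2 \<le> exp E"
  proof -
    have "(2 * x * (q * \<Phi>))\<^sup>2 = (4 * x\<^sup>2) * q * (q * \<Phi>\<^sup>2)"
      by (simp add: power2_eq_square)
    also have "\<dots> \<le> real n * 1 * (q * \<Phi>\<^sup>2)"
    proof (intro mult_mono mult_right_mono)
      have "x\<^sup>2 \<le> (x + 1)\<^sup>2"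
        using m assms(1) by (intro power_mono) auto
      then show "4 * x\<^sup>2 \<le> real n"
        using n by linarith
    qed (use q in auto)
    finally show ?thesis
      using expE by simp
  qed
  also have "exp E = (exp (E / 2))\<^sup>2"
    by (simp add: exp_double[symmetric])
  finally have half: "2 * x * (q * \<Phi>) \<le> exp (E / 2)"
    by (rule power2_le_imp_le) simp
  have "exp E \<le> exp (- 4)" "exp (E / 2) \<le> exp (- 4)"
    using E by auto
  moreover have "exp (- 4) < (1 / 4 :: real)"
    using exp_ge_add_one_self[of 4] by (simp add: exp_minus field_simps)
  ultimately have "real n * (q * \<Phi>\<^sup>2) + 2 * real m * (q * \<Phi>) < 1 / 2"
    using half expE unfolding x_def by linarith
  then show ?thesis
    using path_unsolvable_prob_upper[OF q m(3) \<open>2 * m \<le> n\<close>]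
    unfolding \<Phi>_def q_def l_def by linarith
qed


text \<open>The factor \<open>1 - 200 / r\<close> gains \<open>200 * r\<close> in
  \<open>ln (n * q * g\<^sup>2)\<close>. The losses are \<open>2 * r\<close> from
  \<open>exp (- (2 ^ m / l))\<close>, \<open>96 * r\<close> from the power of
  \<open>1 - 2 * \<delta>\<close>, and lower-order terms, so the \<open>N\<close> blocks almost
  surely suffice for a stuck vertex in the sense of a failure probability below
  \<open>1 / 4\<close>.\<close>

lemma path_solv_prob_below:
  fixes s :: real and n :: nat
  assumes "160000 \<le> s" "real n = 2 powr (s\<^sup>2)" "s * (2 * s + 1) \<le> 2 powr s"
    and "exp 1 * 2 powr s \<le> (real n)\<^sup>2" "12 * s\<^sup>2 + 6 \<le> real n" "s / 2 \<le> s - log 2 s / 2 - 1"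
  shows "path_solv_prob n (inverse (1 + path_density s * (1 - 200 / sqrt s))) < 1 / 2"
proof -
  define r where "r = sqrt s"
  define l where "l = path_density s * (1 - 200 / r)"
  define q where "q = inverse (1 + l)"
  \<comment> \<open>Chosen so that \<open>2 powr y = 2 powr s / r\<close>. This is small enough for
    \<open>2 ^ m / l \<le> r\<close> and large enough for the outer window to weigh
    \<open>O (1 / r)\<close>.\<close>
  define y where "y = s - log 2 s / 2"
  define m where "m = nat \<lfloor>y\<rfloor>"
  define x where "x = real m"
  \<comment> \<open>With \<open>l \<le> 3 * 2 powr s / s\<close> and
    \<open>2 ^ m \<ge> 2 powr s / (2 * r)\<close>, the constant 12 is what
    \<open>2 * l \<le> \<delta> * 2 ^ m\<close> requires.\<close>
  define \<delta> where "\<delta> = 12 / r"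
  \<comment> \<open>This gives \<open>2 ^ M \<ge> n ^ 3\<close>, enough to absorb piles of size
    \<open>D\<close>, while \<open>M\<close> is still only of order \<open>log n\<close>.\<close>
  define M where "M = nat \<lceil>3 * s\<^sup>2\<rceil>"
  define N where "N = n div (2 * M + 1)"
  \<comment> \<open>Makes the probability bound for a large pile, \<open>n * (l / D)\<close>, equal
    to \<open>1 / 8\<close>.\<close>
  define D where "D = 8 * real n * l"
  define g where "g = q ^ m * exp (- (2 ^ m / l)) * (1 - 2 * \<delta>) ^ m * (\<Prod>k\<in>{0<..m}. 2 ^ k) / fact m"
  have r: "400 \<le> r" "r * r = s" "0 < r"
    using assms(1) real_le_rsqrt[of 400 s] by (auto simp: r_def power2_eq_square)
  have e: "0 \<le> 200 / r" "200 / r \<le> 1 / 2"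
    using r by auto
  have y: "s / 2 + 1 \<le> y" "y \<le> s"
    using assms(1,6) by (auto simp: y_def)
  have x: "x \<le> y" "y - 1 \<le> x" "s / 2 \<le> x" "x \<le> s" "1 \<le> m"
    using y assms(1) by (auto simp: m_def x_def) linarith+
  have powy: "2 powr y = 2 powr s / r"
  proof -
    have "2 powr (log 2 s / 2) = (2 powr (log 2 s)) powr (1 / 2)"
      by (simp add: powr_powr)
    also have "\<dots> = r"
      using assms(1) by (simp add: r_def powr_half_sqrt)
    finally show ?thesis
      by (simp add: y_def powr_diff)
  qed
  have two_m: "2 ^ m = 2 powr x"
    by (simp add: x_def powr_realpow)
  have pm: "2 ^ m \<le> 2 powr s / r" "2 powr s / (2 * r) \<le> 2 ^ m"
  proof -
    show "2 ^ m \<le> 2 powr s / r"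
      unfolding two_m powy[symmetric] using x by (intro powr_mono) auto
    have "2 powr s / (2 * r) = 2 powr (y - 1)"
      by (simp add: powr_diff powy)
    also have "\<dots> \<le> 2 ^ m"
      unfolding two_m using x by (intro powr_mono) auto
    finally show "2 powr s / (2 * r) \<le> 2 ^ m" .
  qed
  have l: "2 powr s / s \<le> l" "l \<le> 3 * 2 powr s / s" "l \<le> exp 1 * 2 powr s / s" "0 < l"
  proof -
    have "2 \<le> exp (1::real)"
      using exp_ge_add_one_self[of 1] by simp
    then have "2 * (1 / 2) \<le> exp 1 * (1 - 200 / r)"
      using e by (intro mult_mono) auto
    then have "1 * (2 powr s / s) \<le> (exp 1 * (1 - 200 / r)) * (2 powr s / s)"
      using assms(1) by (intro mult_right_mono) auto
    then show "2 powr s / s \<le> l"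
      by (simp add: l_def path_density_def mult_ac)
    have "0 < 2 powr s / s"
      using assms(1) by simp
    then show "0 < l"
      using \<open>2 powr s / s \<le> l\<close> by linarith
    show *: "l \<le> exp 1 * 2 powr s / s"
      unfolding l_def path_density_def using e assms(1) by (intro mult_left_le) auto
    also have "\<dots> \<le> 3 * 2 powr s / s"
      using assms(1) exp_le by (intro divide_right_mono mult_right_mono) auto
    finally show "l \<le> 3 * 2 powr s / s" .
  qed
  have q: "0 < q" "q \<le> 1"
    using l by (auto simp: q_def field_simps)
  have \<delta>: "0 < \<delta>" "2 * \<delta> \<le> 1 / 2"
    using r by (auto simp: \<delta>_def)
  have ml: "2 ^ m / l \<le> r"
  proof -
    have "2 ^ m / l \<le> (2 powr s / r) / (2 powr s / s)"
      using pm l assms(1) r by (intro frac_le) auto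
    also have "\<dots> = r"
      using r by (simp add: field_simps)
    finally show ?thesis .
  qed
  have lm: "2 * l \<le> \<delta> * 2 ^ m"
  proof -
    have "2 * l \<le> 6 * 2 powr s / (r * r)"
      using l r by simp
    also have "\<dots> = \<delta> * (2 powr s / (2 * r))"
      by (simp add: \<delta>_def)
    also have "\<dots> \<le> \<delta> * 2 ^ m"
      using pm \<delta> by (intro mult_left_mono) auto
    finally show ?thesis .
  qed
  have M: "3 * s\<^sup>2 \<le> real M" "real M \<le> 3 * s\<^sup>2 + 1"
  proof -
    have "- 1 < 3 * s\<^sup>2"
      using zero_le_power2[of s] by linarith
    then have "real M = of_int \<lceil>3 * s\<^sup>2\<rceil>"
      by (simp add: M_def)
    then show "3 * s\<^sup>2 \<le> real M" "real M \<le> 3 * s\<^sup>2 + 1"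
      by linarith+
  qed
  have ss: "s \<le> s\<^sup>2"
    using assms(1) by (simp add: power2_eq_square)
  have "m \<le> M"
  proof -
    have "real m \<le> real M"
      using x M ss assms(1) by (simp add: x_def)
    then show ?thesis
      by simp
  qed
  have n0: "0 < real n"
    using assms(2) by simp
  have D: "0 < D" "D \<le> \<delta> * 2 ^ M"
  proof -
    show "0 < D"
      using n0 l by (simp add: D_def)
    have "D \<le> 8 * real n * ((real n)\<^sup>2 / s)"
      unfolding D_def using l(3) assms(1,4) n0
      by (intro mult_left_mono) (auto intro!: order_trans[OF l(3)] divide_right_mono)
    also have "\<dots> = (8 / s) * real n ^ 3"
      by (simp add: power2_eq_square power3_eq_cube)
    also have "\<dots> \<le> \<delta> * real n ^ 3"
    proof (intro mult_right_mono)
      have "8 / (r * r) \<le> 12 / r"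
        using r(1,3) by (simp add: field_simps)
      then show "8 / s \<le> \<delta>"
        using r by (simp add: \<delta>_def)
    qed auto
    also have "real n ^ 3 = 2 powr (3 * s\<^sup>2)"
      unfolding assms(2) by (simp add: powr_power mult.commute)
    also have "2 powr (3 * s\<^sup>2) \<le> 2 powr real M"
      using M by (intro powr_mono) auto
    also have "2 powr real M = 2 ^ M"
      by (simp add: powr_realpow)
    finally show "D \<le> \<delta> * 2 ^ M"
      using \<delta> by simp
  qed
  \<comment> \<open>Rounding down in \<open>N\<close> costs at most a factor 2, because
    \<open>n\<close> is at least twice the block length.\<close>
  have N: "real n / (2 * (2 * real M + 1)) \<le> real N"
  proof -
    define c where "c = 2 * real M + 1"
    have "n < (N + 1) * (2 * M + 1)"
      unfolding N_def using dividend_less_div_times[of "2 * M + 1" n] by (simp add: algebra_simps)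
    then have "real n < real ((N + 1) * (2 * M + 1))"
      by (simp only: of_nat_less_iff)
    then have "real n < real N * c + c"
      by (simp add: c_def algebra_simps)
    moreover have "2 * c \<le> real n" "0 < c"
      using M assms(5) by (auto simp: c_def)
    ultimately show ?thesis
      unfolding c_def[symmetric] by (simp add: field_simps)
  qed
  have g0: "0 < g"
    unfolding g_def using q \<delta> by (auto intro!: divide_pos_pos mult_pos_pos prod_pos)
  have lng: "2 * ln g = 2 * x * ln q - 2 * (2 ^ m / l) + 2 * x * ln (1 - 2 * \<delta>) + x * (x + 1) * ln 2 - 2 * ln (fact m)"
  proof -
    have "0 < (\<Prod>k\<in>{0<..m}. (2::real) ^ k)"
      by (intro prod_pos) auto
    then have "ln g = x * ln q - 2 ^ m / l + x * ln (1 - 2 * \<delta>) + ln (\<Prod>k\<in>{0<..m}. 2 ^ k) - ln (fact m)"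
      unfolding g_def x_def using q \<delta> by (simp add: ln_mult ln_div ln_realpow)
    then show ?thesis
      using ln_prod_two_powers[of m] by (simp add: x_def)
  qed
  \<comment> \<open>Passing from \<open>1 / l\<close> to \<open>q = 1 / (1 + l)\<close> costs at
    most \<open>1 / l\<close>; over all \<open>2 * x + 1\<close> occurrences this adds up to at most
    1.\<close>
  have lnq: "- (1 + s * ln 2 - ln s - 200 / r) - 1 / l \<le> ln q"
  proof -
    have "ln q = - ln (1 + l)"
      using l(4) by (simp add: q_def ln_inverse)
    also have "1 + l = l * (1 + 1 / l)"
      using l(4) by (simp add: field_simps)
    also have "ln (l * (1 + 1 / l)) = ln l + ln (1 + 1 / l)"
    proof -
      have "0 < 1 + 1 / l"
        using l(4) by (simp add: add_pos_pos)
      then show ?thesis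
        using l(4) by (subst ln_mult) auto
    qed
    also have "ln l = 1 + s * ln 2 - ln s + ln (1 - 200 / r)"
      unfolding l_def using assms(1) e by (intro ln_path_density) auto
    finally have "ln q = - (1 + s * ln 2 - ln s + ln (1 - 200 / r) + ln (1 + 1 / l))" .
    moreover have "ln (1 - 200 / r) \<le> - (200 / r)"
      using e by (intro ln_one_minus_pos_upper_bound) auto
    moreover have "ln (1 + 1 / l) \<le> 1 / l"
      using l by (intro ln_add_one_self_le_self) auto
    ultimately show ?thesis
      by linarith
  qed
  have inv_l: "(2 * x + 1) * (1 / l) \<le> 1"
  proof -
    have "2 * s + 1 \<le> 2 powr s / s"
      using assms(1,3) by (simp add: field_simps)
    then have "2 * x + 1 \<le> l"
      using l x by linarith
    then show ?thesis
      using l by (simp add: field_simps)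
  qed
  \<comment> \<open>From \<open>ln (1 - z) \<ge> - 2 * z\<close> at \<open>z = 2 * \<delta>\<close>:
    the loss is at most \<open>8 * \<delta> * s = 96 * r\<close>.\<close>
  have ln\<delta>: "- 96 * r \<le> 2 * x * ln (1 - 2 * \<delta>)"
  proof -
    have "- (2 * (2 * \<delta>)) \<le> - (2 * \<delta>) - 2 * (2 * \<delta>)\<^sup>2"
      using \<delta> mult_left_mono[of "2 * \<delta>" "1 / 2" "2 * \<delta>"] by (simp add: power2_eq_square)
    also have "\<dots> \<le> ln (1 - 2 * \<delta>)"
      using \<delta> by (intro ln_one_minus_pos_lower_bound) auto
    finally have "2 * x * - (2 * (2 * \<delta>)) \<le> 2 * x * ln (1 - 2 * \<delta>)"
      using x by (intro mult_left_mono) (auto simp: x_def)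
    moreover have "2 * x * (2 * (2 * \<delta>)) \<le> 96 * r"
    proof -
      have "8 * \<delta> * x \<le> 8 * \<delta> * (r * r)"
        using x r \<delta> by (intro mult_left_mono) auto
      moreover have "8 * \<delta> * (r * r) = 96 * r"
        using r(3) by (simp add: \<delta>_def)
      moreover have "2 * x * (2 * (2 * \<delta>)) = 8 * \<delta> * x"
        by simp
      ultimately show ?thesis
        by linarith
    qed
    ultimately show ?thesis
      by simp
  qed
  have lnx: "ln x \<le> ln s"
    using x assms(1) by (subst ln_le_cancel_iff) auto
  have lnfact: "2 * ln (fact m) \<le> 2 * x * ln x - 2 * x + 2 + 2 * ln x"
    using ln_fact_le[OF x(5)] by (simp add: x_def)
  have lns: "ln s \<le> 2 * r"
    unfolding r_def using assms(1) by (intro ln_le_two_sqrt) auto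
  \<comment> \<open>The target \<open>288 * s\<^sup>2\<close> is \<open>4 * 2 * 4\<close> times the
    bound \<open>9 * s\<^sup>2\<close> on the block length; it makes the expected number of stuck
    centres in the bound at least 4.\<close>
  have "ln (288 * s\<^sup>2) = ln 288 + 2 * ln s"
    using assms(1) by (simp add: ln_mult ln_realpow)
  also have "\<dots> \<le> 287 + 2 * ln s"
    using ln_le_minus_one[of 288] by simp
  also have "\<dots> \<le> (- 1) - 1 - 3 + 0 - ln s - 98 * r + 200 * r"
    using r lns by simp
  \<comment> \<open>The distance of \<open>x\<close> from \<open>s\<close> enters as a square with
    positive sign, so choosing \<open>m\<close> below \<open>s\<close> by about
    \<open>log 2 s / 2\<close> does no harm in this term.\<close>
  also have "\<dots> \<le> ln 2 * ((s - x)\<^sup>2 - (s - x)) - (2 * x + 1) * (1 / l) - 3 + 2 * x * (ln s - ln x)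
      + (ln s - 2 * ln x) - 98 * r + (2 * x + 1) * (200 / r)"
  proof -
    have "- 1 \<le> ln 2 * ((s - x)\<^sup>2 - (s - x))"
    proof -
      have "0 \<le> (s - x - 1 / 2)\<^sup>2"
        by simp
      then have "- 1 \<le> (s - x)\<^sup>2 - (s - x)"
        by (simp add: power2_eq_square algebra_simps)
      then have "ln 2 * (- 1) \<le> ln 2 * ((s - x)\<^sup>2 - (s - x))"
        by (intro mult_left_mono) auto
      then show ?thesis
        using ln_2_less_1 by linarith
    qed
    moreover have "0 \<le> 2 * x * (ln s - ln x)"
      using lnx by (simp add: x_def)
    moreover have "200 * r \<le> (2 * x + 1) * (200 / r)"
    proof -
      have "r * r * (200 / r) \<le> (2 * x + 1) * (200 / r)"
        using r x by (intro mult_right_mono) auto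
      moreover have "r * r * (200 / r) = 200 * r"
        using r(3) by simp
      ultimately show ?thesis
        by simp
    qed
    ultimately show ?thesis
      using inv_l lnx by linarith
  qed
  also have "\<dots> = s\<^sup>2 * ln 2 + (2 * x + 1) * (- (1 + s * ln 2 - ln s - 200 / r) - 1 / l) - 2 * r - 96 * r
      + x * (x + 1) * ln 2 - (2 * x * ln x - 2 * x + 2 + 2 * ln x)"
    by (simp add: algebra_simps power2_eq_square)
  also have "\<dots> \<le> s\<^sup>2 * ln 2 + (2 * x + 1) * ln q - 2 * (2 ^ m / l) + 2 * x * ln (1 - 2 * \<delta>)
      + x * (x + 1) * ln 2 - 2 * ln (fact m)"
  proof -
    have "(2 * x + 1) * (- (1 + s * ln 2 - ln s - 200 / r) - 1 / l) \<le> (2 * x + 1) * ln q"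
      using x assms(1) by (intro mult_left_mono lnq) auto
    then show ?thesis
      using ml ln\<delta> lnfact by linarith
  qed
  also have "\<dots> = ln (real n) + ln q + 2 * ln g"
    unfolding lng assms(2) by (simp add: ln_powr algebra_simps)
  also have "\<dots> = ln (real n * q * g\<^sup>2)"
    using n0 q g0 by (simp add: ln_mult ln_realpow)
  finally have big: "288 * s\<^sup>2 \<le> real n * q * g\<^sup>2"
    using n0 q g0 assms(1) by (subst (asm) ln_le_cancel_iff) auto
  have "4 \<le> (q * g\<^sup>2 / 4) * real N"
  proof -
    have "2 * M + 1 \<le> 9 * s\<^sup>2"
      using M ss assms(1) by simp
    then have "4 * (2 * (2 * real M + 1) * 4) \<le> 288 * s\<^sup>2"
      by simp
    also have "\<dots> \<le> real n * q * g\<^sup>2"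
      by (rule big)
    finally have "4 \<le> (q * g\<^sup>2 / 4) * (real n / (2 * (2 * real M + 1)))"
      by (simp add: field_simps)
    also have "\<dots> \<le> (q * g\<^sup>2 / 4) * real N"
      using N q by (intro mult_left_mono) auto
    finally show ?thesis .
  qed
  then have "exp (- (q * g\<^sup>2 / 4) * real N) \<le> exp (- 4)"
    by simp
  also have "exp (- 4) < (1 / 4 :: real)"
    using exp_ge_add_one_self[of 4] by (simp add: exp_minus field_simps)
  finally have "exp (- (q * g\<^sup>2 / 4) * real N) < 1 / 4" .
  moreover have "path_solv_prob n q \<le> exp (- (q * g\<^sup>2 / 4) * real N) + real n * (l / D)"
  proof -
    have "N * (2 * M + 1) \<le> n"
      unfolding N_def by (rule div_times_less_eq_dividend)
    then show ?thesis
      unfolding q_def g_def using l(4) \<delta> lm D \<open>m \<le> M\<close> by (intro path_solv_prob_upper) auto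
  qed
  moreover have "real n * (l / D) = 1 / 8"
    using n0 l by (simp add: D_def)
  ultimately have "path_solv_prob n q < 1 / 2"
    by linarith
  then show ?thesis
    by (simp add: q_def l_def r_def)
qed

section \<open>Passage to the asymptotic formula\<close>

theorem theorem16:
  "(\<lambda>n. geom_threshold_path n
        - exp 1 * 2 powr sqrt (log 2 (real n)) / sqrt (log 2 (real n)) * real n)
   \<in> O(\<lambda>n. exp 1 * 2 powr sqrt (log 2 (real n)) / sqrt (log 2 (real n)) * real n
            / ln (real n) powr (1/4))"
proof (rule bigoI)
  define S where "S n = sqrt (log 2 (real n))" for n :: nat
  \<comment> \<open>The growth conditions required by the bounds above and below;
    \<open>160000 = 400\<^sup>2\<close> makes the relative error \<open>200 / sqrt s\<close> at most
    \<open>1 / 2\<close>.\<close>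
  have "eventually (\<lambda>n. 160000 \<le> S n) at_top" "eventually (\<lambda>n. 4 * (S n + 2)\<^sup>2 \<le> real n) at_top"
    "eventually (\<lambda>n. S n * (2 * S n + 1) \<le> 2 powr S n) at_top"
    "eventually (\<lambda>n. exp 1 * 2 powr S n \<le> (real n)\<^sup>2) at_top"
    "eventually (\<lambda>n. 12 * (S n)\<^sup>2 + 6 \<le> real n) at_top"
    "eventually (\<lambda>n. S n / 2 \<le> S n - log 2 (S n) / 2 - 1) at_top"
    unfolding S_def by real_asymp+
  then show "eventually (\<lambda>n. norm (geom_threshold_path n
        - exp 1 * 2 powr sqrt (log 2 (real n)) / sqrt (log 2 (real n)) * real n)
      \<le> 200 * norm (exp 1 * 2 powr sqrt (log 2 (real n)) / sqrt (log 2 (real n)) * real n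
            / ln (real n) powr (1/4))) at_top"
    using eventually_ge_at_top[of 2]
  proof eventually_elim
    case (elim n)
    define s where "s = S n"
    define e where "e = 200 / sqrt s"
    have s: "160000 \<le> s"
      using elim by (simp add: s_def)
    have log0: "0 < log 2 (real n)"
      using elim(7) by simp
    have n: "real n = 2 powr (s\<^sup>2)"
      using elim(7) log0 by (simp add: s_def S_def)
    have e: "0 < e" "e \<le> 1 / 2"
    proof -
      have "400 \<le> sqrt s"
        using s by (intro real_le_rsqrt) auto
      moreover have "0 < sqrt s"
        using s by simp
      ultimately show "0 < e" "e \<le> 1 / 2"
        unfolding e_def by (auto simp only: pos_divide_le_eq divide_pos_pos)
    qed
    have pd: "0 < path_density s"
      using s by (simp add: path_density_def)
    have "path_density s * (1 - e) * real n < geom_threshold_path n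
        \<and> geom_threshold_path n < path_density s * (1 + e) * real n"
    proof (rule geom_threshold_path_between)
      show "path_solv_prob n (inverse (1 + path_density s * (1 - e))) < 1 / 2"
        unfolding e_def using elim n by (intro path_solv_prob_below) (auto simp: s_def)
      show "1 / 2 < path_solv_prob n (inverse (1 + path_density s * (1 + e)))"
        unfolding e_def using elim n by (intro path_solv_prob_above) (auto simp: s_def)
      show "path_density s * (1 - e) < path_density s * (1 + e)"
        using pd e by (intro mult_strict_left_mono) auto
    qed (use pd e elim(7) in auto)
    then have "\<bar>geom_threshold_path n - path_density s * real n\<bar> \<le> path_density s * real n * e"
      by (simp add: algebra_simps abs_le_iff)
    also have "\<dots> \<le> path_density s * real n * (200 / ln (real n) powr (1 / 4))"
    proof -
      \<comment> \<open>As \<open>sqrt s\<close> is the fourth root of \<open>log 2 n\<close>, this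
        turns the error \<open>1 / sqrt s\<close> into one in terms of \<open>ln n\<close>.\<close>
      have "ln (real n) \<le> log 2 (real n)"
      proof -
        have "ln (real n) * ln 2 \<le> ln (real n) * 1"
          using ln_2_less_1 elim(7) by (intro mult_left_mono) auto
        then show ?thesis
          by (simp add: log_def field_simps)
      qed
      then have "ln (real n) powr (1 / 4) \<le> log 2 (real n) powr (1 / 4)"
        using elim(7) by (intro powr_mono2) auto
      also have "\<dots> = (log 2 (real n) powr (1 / 2)) powr (1 / 2)"
        by (simp add: powr_powr)
      also have "\<dots> = sqrt s"
        using log0 by (simp add: s_def S_def powr_half_sqrt)
      finally have "e \<le> 200 / ln (real n) powr (1 / 4)"
        unfolding e_def using elim(7) s by (intro divide_left_mono mult_pos_pos) auto
      then show ?thesis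
        using pd by (intro mult_left_mono) auto
    qed
    also have "\<dots> = 200 * norm (path_density s * real n / ln (real n) powr (1 / 4))"
      using pd by (simp add: abs_mult)
    finally show ?case
      by (simp add: path_density_def s_def S_def)
  qed
qed

end
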